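(* Let $G$ be an ordered group and let $S$ be a finite subset of $G$. If $|S|\ge 4$ and $|S^2|=3|S|-2$, then $\langle S\rangle$ is either abelian or young.
   Context: An ordered group is a group $G$ with a total order $\le$ such that $a\le b$ implies $xay\le xby$ for all $a,b,x,y\in G$. For a subset $S$, $S^2=\{x_1x_2 : x_1,x_2\in S\}$, and $\langle S\rangle$ is the subgroup generated by $S$. Notation: $[a,b]=a^{-1}b^{-1}ab$ and $a^b=b^{-1}ab$. An ordered group $H$ is called young if one of the following holds: (i) $H=\langle a,b\rangle$ with $[[a,b],a]=[[a,b],b]=1$; (ii) $H=\langle a\rangle\times\langle b,c\rangle$ with either $c^b=c^2$ or $(c^2)^b=c$, and $c\ne 1$; (iii) $H=\langle a,b\rangle$ with $a^b=a^2$ and $a\ne 1$; (iv) $H=\langle a,b\rangle$ with $a^{b^2}=aa^b$, $[a,a^b]=1$ and $a\ne 1$. *)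

theory Defs
  imports "HOL-Algebra.Algebra"
begin

text \<open>The order is a relation on the carrier: \<^term>\<open>(a, b) \<in> r\<close> stands for a \<open>\<le>\<close> b.\<close>

locale ordered_group = group G for G (structure) +
  fixes r :: "('a \<times> 'a) set"
  assumes linear_order: "linear_order_on (carrier G) r"
    and order_mult_mono:
      "\<lbrakk>a \<in> carrier G; b \<in> carrier G; x \<in> carrier G; y \<in> carrier G; (a, b) \<in> r\<rbrakk>
        \<Longrightarrow> (x \<otimes> a \<otimes> y, x \<otimes> b \<otimes> y) \<in> r"

definition comm :: "('a, 'm) monoid_scheme \<Rightarrow> 'a \<Rightarrow> 'a \<Rightarrow> 'a"
  where "comm G a b = inv\<^bsub>G\<^esub> a \<otimes>\<^bsub>G\<^esub> inv\<^bsub>G\<^esub> b \<otimes>\<^bsub>G\<^esub> a \<otimes>\<^bsub>G\<^esub> b"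

definition conj_by :: "('a, 'm) monoid_scheme \<Rightarrow> 'a \<Rightarrow> 'a \<Rightarrow> 'a"
  where "conj_by G a b = inv\<^bsub>G\<^esub> b \<otimes>\<^bsub>G\<^esub> a \<otimes>\<^bsub>G\<^esub> b"

text \<open>H is the internal direct product of the subgroups generated by A and by B when the
  multiplication map is an isomorphism from their external direct product onto H; see
  \<open>iso_group_mul_eq\<close> in \<^theory>\<open>HOL-Algebra.Elementary_Groups\<close> for the description by
  normal subgroups with trivial intersection.\<close>

definition internal_direct_product :: "('a, 'm) monoid_scheme \<Rightarrow> 'a set \<Rightarrow> 'a set \<Rightarrow> bool"
  where "internal_direct_product H A B \<longleftrightarrow>
    (\<lambda>(x, y). x \<otimes>\<^bsub>H\<^esub> y) \<in> iso (subgroup_generated H A \<times>\<times> subgroup_generated H B) H"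

definition young :: "('a, 'm) monoid_scheme \<Rightarrow> ('a \<times> 'a) set \<Rightarrow> bool"
  where "young H r \<longleftrightarrow> ordered_group H r \<and>
    ((\<exists>a\<in>carrier H. \<exists>b\<in>carrier H.
        carrier H = generate H {a, b} \<and>
        comm H (comm H a b) a = \<one>\<^bsub>H\<^esub> \<and> comm H (comm H a b) b = \<one>\<^bsub>H\<^esub>) \<or>
     (\<exists>a\<in>carrier H. \<exists>b\<in>carrier H. \<exists>c\<in>carrier H.
        internal_direct_product H {a} {b, c} \<and>
        (conj_by H c b = c [^]\<^bsub>H\<^esub> (2::nat) \<or> conj_by H (c [^]\<^bsub>H\<^esub> (2::nat)) b = c) \<and>
        c \<noteq> \<one>\<^bsub>H\<^esub>) \<or>
     (\<exists>a\<in>carrier H. \<exists>b\<in>carrier H.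
        carrier H = generate H {a, b} \<and>
        conj_by H a b = a [^]\<^bsub>H\<^esub> (2::nat) \<and> a \<noteq> \<one>\<^bsub>H\<^esub>) \<or>
     (\<exists>a\<in>carrier H. \<exists>b\<in>carrier H.
        carrier H = generate H {a, b} \<and>
        conj_by H a (b [^]\<^bsub>H\<^esub> (2::nat)) = a \<otimes>\<^bsub>H\<^esub> conj_by H a b \<and>
        comm H a (conj_by H a b) = \<one>\<^bsub>H\<^esub> \<and> a \<noteq> \<one>\<^bsub>H\<^esub>))"

end

theory Submission
  imports Defs
begin

text \<open>
  Write \<open>S = {x\<^sub>1 < \<dots> < x\<^sub>k}\<close>. If \<open>S\<close> does not commute, then removing \<open>x\<^sub>k\<close> from \<open>S\<close> removes at least three
  products as long as the remaining set \<open>T\<close> does not commute, and if \<open>T\<close> commutes then \<open>T\<^sup>2\<close> has at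
  least \<open>2|T| - 1\<close> elements while \<open>x\<^sub>kT \<union> Tx\<^sub>k\<close> is disjoint from it and has more than \<open>|T|\<close> elements. By
  induction a noncommuting \<open>S\<close> satisfies \<open>|S\<^sup>2| \<ge> 3|S| - 2\<close>. In the case of equality with \<open>k \<ge> 4\<close>, one of
  the two end points can be removed so that \<open>T\<close> still does not commute; then equality holds for \<open>T\<close>
  as well, and some product \<open>x\<^sub>kt\<close> lies in \<open>T\<^sup>2\<close>, so that \<open>S\<close> and \<open>T\<close> generate the same subgroup. This
  leaves four elements \<open>a < b < c < d\<close>. If three consecutive ones commute, they form a progression on
  which conjugation by the fourth acts almost as a permutation, which gives families (i) and (ii).
  Otherwise both triples have squares of size 7, and comparing \<open>ac\<close>, \<open>ca\<close>, \<open>bd\<close>, \<open>db\<close>, \<open>ad\<close>, \<open>da\<close> with the ten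
  known products leaves finitely many systems of relations. Reversal of the order and inversion of
  all elements are symmetries of the situation that identify most of them.
\<close>

text \<open>Two properties of ordered groups carry all arguments: strict monotonicity of
  multiplication, which separates products, and uniqueness of roots, by which an element that
  commutes with a power of \<open>x\<close> commutes with \<open>x\<close>. The value
  \<open>3|S| - 2\<close> is 7 for three elements and 10 for four, so seven products of a triple
  together with three further ones are already the whole square, and every other product must
  coincide with one of them. These coincidences are equations between positive words, solved by
  substitution and cancellation; the families are therefore kept in that form and turned into
  conjugates and commutators only at the end. The set is always assumed to generate the whole group,
  so that relations between a few elements describe it completely. The one property that no word
  equation displays is the direct product in family (ii): the factors \<open><a>\<close> and
  \<open><b, c>\<close> must meet trivially. Their intersection commutes with \<open>b\<close> and
  \<open>c\<close>, so it suffices that \<open><b, c>\<close> has trivial centre, which again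
  follows from uniqueness of roots.\<close>

lemma set_mult_iff: "z \<in> A <#>\<^bsub>G\<^esub> B \<longleftrightarrow> (\<exists>x\<in>A. \<exists>y\<in>B. z = x \<otimes>\<^bsub>G\<^esub> y)"
  by (auto simp: set_mult_def)

lemma set_multI: "\<lbrakk>x \<in> A; y \<in> B\<rbrakk> \<Longrightarrow> x \<otimes>\<^bsub>G\<^esub> y \<in> A <#>\<^bsub>G\<^esub> B"
  by (auto simp: set_mult_def)

lemma set_mult_disjointI:
  "(\<And>n p q. \<lbrakk>n \<in> N; p \<in> A; q \<in> B\<rbrakk> \<Longrightarrow> n \<noteq> p \<otimes>\<^bsub>G\<^esub> q) \<Longrightarrow> N \<inter> (A <#>\<^bsub>G\<^esub> B) = {}"
  unfolding set_mult_iff disjoint_iff by blast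

lemma set_mult_finite: "\<lbrakk>finite A; finite B\<rbrakk> \<Longrightarrow> finite (A <#>\<^bsub>G\<^esub> B)"
  by (auto simp: set_mult_def)

lemma card_add_new:
  assumes "finite U" "V \<subseteq> U" "N \<subseteq> U" "N \<inter> V = {}"
  shows "card V + card N \<le> card U"
proof -
  have "card V + card N = card (V \<union> N)"
    using assms by (intro card_Un_disjoint [symmetric]) (auto intro: finite_subset)
  also have "\<dots> \<le> card U"
    using assms by (intro card_mono) auto
  finally show ?thesis .
qed

lemma linear_order_total_relation:
  assumes "linear_order_on A s" "x \<in> A" "y \<in> A"
  shows "(x, y) \<in> s \<or> (y, x) \<in> s"
  using assms by (cases "x = y") (auto simp: order_on_defs total_on_def refl_on_def)

lemma linear_order_relation_facts:
  assumes "linear_order_on A s"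
  shows "\<And>x. x \<in> A \<Longrightarrow> (x, x) \<in> s"
    and "\<And>x y z. \<lbrakk>(x, y) \<in> s; (y, z) \<in> s\<rbrakk> \<Longrightarrow> (x, z) \<in> s"
    and "\<And>x y. \<lbrakk>(x, y) \<in> s; (y, x) \<in> s\<rbrakk> \<Longrightarrow> x = y"
  using assms by (auto simp: order_on_defs refl_on_def trans_def antisym_def)

lemma card_square_insert_new:
  assumes "finite T" "N \<subseteq> insert x T <#>\<^bsub>G\<^esub> insert x T" "N \<inter> (T <#>\<^bsub>G\<^esub> T) = {}"
  shows "card (T <#>\<^bsub>G\<^esub> T) + card N \<le> card (insert x T <#>\<^bsub>G\<^esub> insert x T)"
  using assms by (intro card_add_new set_mult_finite mono_set_mult) auto

context group
begin

lemma inv_mult_cancel [simp]: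
  "\<lbrakk>x \<in> carrier G; y \<in> carrier G\<rbrakk> \<Longrightarrow> inv x \<otimes> (x \<otimes> y) = y"
  by (simp flip: m_assoc)

lemma mult_inv_cancel [simp]:
  "\<lbrakk>x \<in> carrier G; y \<in> carrier G\<rbrakk> \<Longrightarrow> x \<otimes> (inv x \<otimes> y) = y"
  by (simp flip: m_assoc)

lemma conj_eq_iff:
  assumes "x \<in> carrier G" "y \<in> carrier G" "z \<in> carrier G"
  shows "inv y \<otimes> x \<otimes> y = z \<longleftrightarrow> x \<otimes> y = y \<otimes> z"
proof -
  have "inv y \<otimes> x \<otimes> y = z \<longleftrightarrow> y \<otimes> (inv y \<otimes> (x \<otimes> y)) = y \<otimes> z"
    using assms l_cancel[of y "inv y \<otimes> (x \<otimes> y)" z] by (simp add: m_assoc del: mult_inv_cancel)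
  then show ?thesis
    using assms by simp
qed

definition commuting :: "'a set \<Rightarrow> bool"
  where "commuting T \<longleftrightarrow> (\<forall>x\<in>T. \<forall>y\<in>T. x \<otimes> y = y \<otimes> x)"

end

section \<open>The order on the type, its symmetries, and uniqueness of roots\<close>

context ordered_group
begin

text \<open>The order is extended to the whole type, so that the library on the class
  \<^class>\<open>linorder\<close> applies; the values outside the carrier are irrelevant.\<close>

definition le where "le x y \<longleftrightarrow>
  (if x \<in> carrier G then y \<in> carrier G \<longrightarrow> (x, y) \<in> r
   else y \<notin> carrier G \<and> (x, y) \<in> (SOME s. well_order_on UNIV s))"

definition lt where "lt x y \<longleftrightarrow> le x y \<and> x \<noteq> y"

text \<open>An ordinal-sum construction: the carrier with \<open>r\<close> at the bottom, and above
  it all other elements under an arbitrary well-order, whose existence supplies a linear order on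
  any type.\<close>

lemma le_linorder: "class.linorder le lt"
proof -
  define s :: "('a \<times> 'a) set" where "s = (SOME s. well_order_on UNIV s)"
  have "well_order_on UNIV s"
    unfolding s_def by (rule someI_ex[OF well_order_on])
  then have s: "linear_order_on UNIV s"
    by (simp add: well_order_on_def)
  have le: "le x y \<longleftrightarrow> (if x \<in> carrier G then y \<in> carrier G \<longrightarrow> (x, y) \<in> r
    else y \<notin> carrier G \<and> (x, y) \<in> s)" for x y
    unfolding le_def s_def ..
  note f = linear_order_relation_facts[OF s] linear_order_relation_facts[OF linear_order]
  have refl: "le x x" for x
    using f(1,4) by (auto simp: le)
  have trans: "le x y \<Longrightarrow> le y z \<Longrightarrow> le x z" for x y z
    using f(2)[of x y z] f(5)[of x y z] by (auto simp: le split: if_splits)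
  have antisym: "le x y \<Longrightarrow> le y x \<Longrightarrow> x = y" for x y
    using f(3)[of x y] f(6)[of x y] by (auto simp: le split: if_splits)
  have total: "le x y \<or> le y x" for x y
    using linear_order_total_relation[OF s, of x y] linear_order_total_relation[OF linear_order, of x y]
    by (auto simp: le)
  show ?thesis
    by unfold_locales (use refl trans antisym total in \<open>auto simp: lt_def\<close>)
qed

sublocale ord: linorder le lt by (rule le_linorder)

lemma le_iff: "\<lbrakk>x \<in> carrier G; y \<in> carrier G\<rbrakk> \<Longrightarrow> le x y \<longleftrightarrow> (x, y) \<in> r"
  by (simp add: le_def)

lemma le_mult_left: "\<lbrakk>x \<in> carrier G; y \<in> carrier G; z \<in> carrier G; le x y\<rbrakk> \<Longrightarrow> le (z \<otimes> x) (z \<otimes> y)"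
  using order_mult_mono[of x y z \<one>] by (simp add: le_iff)

lemma le_mult_right: "\<lbrakk>x \<in> carrier G; y \<in> carrier G; z \<in> carrier G; le x y\<rbrakk> \<Longrightarrow> le (x \<otimes> z) (y \<otimes> z)"
  using order_mult_mono[of x y \<one> z] by (simp add: le_iff)

lemma le_mult_left_iff [simp]:
  "\<lbrakk>x \<in> carrier G; y \<in> carrier G; z \<in> carrier G\<rbrakk> \<Longrightarrow> le (z \<otimes> x) (z \<otimes> y) \<longleftrightarrow> le x y"
  using le_mult_left[of "z \<otimes> x" "z \<otimes> y" "inv z"] le_mult_left[of x y z] by auto

lemma le_mult_right_iff [simp]:
  "\<lbrakk>x \<in> carrier G; y \<in> carrier G; z \<in> carrier G\<rbrakk> \<Longrightarrow> le (x \<otimes> z) (y \<otimes> z) \<longleftrightarrow> le x y"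
  using le_mult_right[of "x \<otimes> z" "y \<otimes> z" "inv z"] le_mult_right[of x y z] by (auto simp: m_assoc)

lemma lt_mult_left [simp]:
  "\<lbrakk>x \<in> carrier G; y \<in> carrier G; z \<in> carrier G\<rbrakk> \<Longrightarrow> lt (z \<otimes> x) (z \<otimes> y) \<longleftrightarrow> lt x y"
  by (simp add: lt_def)

lemma lt_mult_right [simp]:
  "\<lbrakk>x \<in> carrier G; y \<in> carrier G; z \<in> carrier G\<rbrakk> \<Longrightarrow> lt (x \<otimes> z) (y \<otimes> z) \<longleftrightarrow> lt x y"
  by (simp add: lt_def)

lemma lt_le_mult_mono:
  "\<lbrakk>x \<in> carrier G; y \<in> carrier G; u \<in> carrier G; v \<in> carrier G; lt x u; le y v\<rbrakk>
    \<Longrightarrow> lt (x \<otimes> y) (u \<otimes> v)"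
  by (meson le_mult_left lt_mult_right m_closed ord.less_le_trans)

lemma le_lt_mult_mono:
  "\<lbrakk>x \<in> carrier G; y \<in> carrier G; u \<in> carrier G; v \<in> carrier G; le x u; lt y v\<rbrakk>
    \<Longrightarrow> lt (x \<otimes> y) (u \<otimes> v)"
  by (meson le_mult_right lt_mult_left m_closed ord.le_less_trans)

text \<open>The axioms do not distinguish the two directions of the order, so each statement about a
  greatest element, interpreted in this group, yields the one about a least element.\<close>

lemma ordered_group_converse: "ordered_group G (r\<inverse>)"
proof (intro ordered_group.intro ordered_group_axioms.intro)
  show "linear_order_on (carrier G) (r\<inverse>)"
    using linear_order by simp
qed (use order_mult_mono is_group in auto)

text \<open>Restricted to the carrier, because elements outside it stay on top in both extended
  orders.\<close>

lemma lt_converse: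
  "\<lbrakk>x \<in> carrier G; y \<in> carrier G\<rbrakk> \<Longrightarrow> ordered_group.lt G (r\<inverse>) x y \<longleftrightarrow> lt y x"
  using ordered_group_converse
  by (auto simp: lt_def le_def ordered_group.lt_def ordered_group.le_def)

lemma lt_inv: "\<lbrakk>x \<in> carrier G; y \<in> carrier G\<rbrakk> \<Longrightarrow> lt (inv x) (inv y) \<longleftrightarrow> lt y x"
  using lt_mult_left[of "inv x" "inv y" y] lt_mult_right[of "y \<otimes> inv x" \<one> x]
  by (simp add: m_assoc)

lemma ex_greatest:
  assumes "finite T" "T \<noteq> {}"
  obtains m where "m \<in> T" "\<And>t. t \<in> T \<Longrightarrow> le t m"
  using ord.Max_in[OF assms] ord.Max_ge[OF assms(1)] by blast

lemma pow_strict_mono: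
  assumes "x \<in> carrier G" "y \<in> carrier G" "lt x y" "n > 0"
  shows "lt (x [^] (n::nat)) (y [^] n)"
  using \<open>n > 0\<close>
proof (induction n rule: nat_induct_non_zero)
  case (Suc n)
  then show ?case
    using assms by (simp add: lt_le_mult_mono)
qed (use assms in simp)

lemma pow_inj:
  assumes "x \<in> carrier G" "y \<in> carrier G" "x [^] (n::nat) = y [^] n" "n > 0"
  shows "x = y"
  using assms pow_strict_mono[of x y n] pow_strict_mono[of y x n] by (metis ord.less_irrefl ord.neqE)

lemma conj_pow:
  assumes "x \<in> carrier G" "y \<in> carrier G"
  shows "(inv y \<otimes> x \<otimes> y) [^] (n::nat) = inv y \<otimes> x [^] n \<otimes> y"
  using assms by (induction n) (simp_all add: m_assoc)

text \<open>Conjugation by \<open>y\<close> fixes the power of \<open>x\<close>, so \<open>x\<close>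
  and its conjugate are roots of the same element and coincide.\<close>

lemma pow_commute_imp_commute:
  assumes "x \<in> carrier G" "y \<in> carrier G" "x [^] (n::nat) \<otimes> y = y \<otimes> x [^] n" "n > 0"
  shows "x \<otimes> y = y \<otimes> x"
proof -
  have "(inv y \<otimes> x \<otimes> y) [^] n = inv y \<otimes> (x [^] n \<otimes> y)"
    using conj_pow[OF assms(1,2)] assms by (simp add: m_assoc)
  also have "\<dots> = x [^] n"
    using assms by simp
  finally have "(inv y \<otimes> x \<otimes> y) [^] n = x [^] n" .
  then have "inv y \<otimes> x \<otimes> y = x"
    using pow_inj[of "inv y \<otimes> x \<otimes> y" x n] assms(1,2,4) by simp
  then show ?thesis
    using assms by (simp add: conj_eq_iff)
qed

lemma square_commute_imp_commute:
  assumes "x \<in> carrier G" "y \<in> carrier G" "x \<otimes> x \<otimes> y = y \<otimes> (x \<otimes> x)"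
  shows "x \<otimes> y = y \<otimes> x"
proof -
  have "x [^] (2::nat) = x \<otimes> x"
    using assms(1) by (simp add: numeral_2_eq_2)
  then show ?thesis
    using assms pow_commute_imp_commute[of x y 2] by simp
qed

subsection \<open>Growth of product sets\<close>

text \<open>Each new maximum \<open>x\<close> contributes \<open>xm\<close> and \<open>xx\<close>,
  where \<open>m\<close> is the previous maximum; both exceed every earlier product.\<close>

lemma card_square_ge:
  assumes "finite T" "T \<subseteq> carrier G" "T \<noteq> {}"
  shows "2 * card T \<le> card (T <#> T) + 1"
  using assms
proof (induction T rule: ord.finite_linorder_max_induct)
  case (insert x T)
  show ?case
  proof (cases "T = {}")
    case True
    then show ?thesis by (simp add: set_mult_def)
  next
    case False
    obtain m where m: "m \<in> T" "\<And>t. t \<in> T \<Longrightarrow> le t m"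
      using ex_greatest insert.hyps(1) False by blast
    have c: "x \<in> carrier G" "\<And>t. t \<in> T \<Longrightarrow> t \<in> carrier G"
      using insert.prems by auto
    have ne: "x \<otimes> m \<noteq> p \<otimes> q" "x \<otimes> x \<noteq> p \<otimes> q" if pq: "p \<in> T" "q \<in> T" for p q
    proof -
      have "lt p x" "lt q x" "le q m" "p \<in> carrier G" "q \<in> carrier G" "m \<in> carrier G"
        using insert.hyps(2) m c pq by auto
      then show "x \<otimes> m \<noteq> p \<otimes> q" "x \<otimes> x \<noteq> p \<otimes> q"
        using lt_le_mult_mono[of p q x m] lt_le_mult_mono[of p q x x] c(1) by (auto simp: ord.less_imp_le)
    qed
    have new: "{x \<otimes> m, x \<otimes> x} \<inter> (T <#> T) = {}"
      by (rule set_mult_disjointI) (elim insertE emptyE; simp add: ne)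
    have "card (T <#> T) + card {x \<otimes> m, x \<otimes> x} \<le> card (insert x T <#> insert x T)"
      by (rule card_square_insert_new[OF insert.hyps(1) _ new]) (simp add: set_multI m(1))
    moreover have "m \<noteq> x"
      using m insert.hyps(2) by auto
    then have "card {x \<otimes> m, x \<otimes> x} = 2"
      using c m by (simp add: l_cancel)
    moreover have "card (insert x T) = card T + 1"
      using insert.hyps by (metis Suc_eq_plus1 card_insert_disjoint ord.less_irrefl)
    ultimately show ?thesis
      using insert False by auto
  qed
qed simp

text \<open>Neither \<open>xT\<close> nor \<open>Tx\<close> meets \<open>T\<^sup>2\<close>, as \<open>x\<close> would then commute with \<open>T\<close>; and they differ, since
  an order automorphism of a finite chain is trivial.\<close>

lemma card_square_insert_commuting:
  assumes "finite T" "T \<subseteq> carrier G" "x \<in> carrier G" "\<And>t. t \<in> T \<Longrightarrow> lt t x"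
    and "commuting T" "\<not> commuting (insert x T)"
  shows "card (T <#> T) + card ((x <# T) \<union> (T #> x)) + 1 \<le> card (insert x T <#> insert x T)"
    and "card T + 1 \<le> card ((x <# T) \<union> (T #> x))"
proof -
  have c: "\<And>t. t \<in> T \<Longrightarrow> t \<in> carrier G"
    using assms by auto
  obtain s where s: "s \<in> T" "s \<otimes> x \<noteq> x \<otimes> s"
    using assms(5,6) unfolding commuting_def by force
  let ?N = "(x <# T) \<union> (T #> x)"
  have cos: "x <# T = (\<lambda>t. x \<otimes> t) ` T" "T #> x = (\<lambda>t. t \<otimes> x) ` T"
    by (auto simp: l_coset_def r_coset_def)
  have "x \<otimes> x \<noteq> x \<otimes> t" "x \<otimes> x \<noteq> t \<otimes> x" if "t \<in> T" for t
    using assms(3,4) c that ord.less_irrefl by auto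
  moreover have "x \<otimes> x \<noteq> p \<otimes> q" if "p \<in> T" "q \<in> T" for p q
    using that assms(3,4) c lt_le_mult_mono[of p q x x] by (metis ord.less_imp_le ord.less_irrefl)
  ultimately have xx: "x \<otimes> x \<notin> ?N" "x \<otimes> x \<notin> T <#> T"
    by (auto simp: cos set_mult_iff)
  \<comment> \<open>The witness \<open>s\<close> commutes with all of \<open>T\<close>, hence with
    every element of its square. If \<open>xt\<close> or \<open>tx\<close> were such an element,
    cancelling \<open>t\<close> would make \<open>s\<close> commute with \<open>x\<close>.\<close>
  have new: "x \<otimes> t \<notin> T <#> T" "t \<otimes> x \<notin> T <#> T" if t: "t \<in> T" for t
  proof -
    have st: "s \<otimes> t = t \<otimes> s"
      using assms(5) s t by (auto simp: commuting_def)
    have pq: "s \<otimes> (p \<otimes> q) = p \<otimes> q \<otimes> s" if "p \<in> T" "q \<in> T" for p q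
      using assms(5) s that c by (metis commuting_def m_assoc)
    show "x \<otimes> t \<notin> T <#> T"
    proof
      assume "x \<otimes> t \<in> T <#> T"
      then have "s \<otimes> (x \<otimes> t) = x \<otimes> t \<otimes> s"
        using pq by (auto simp: set_mult_iff)
      then have "s \<otimes> x \<otimes> t = x \<otimes> s \<otimes> t"
        using c s t assms(3) st by (simp add: m_assoc)
      then show False
        using s t c assms(3) by (metis m_closed r_cancel)
    qed
    show "t \<otimes> x \<notin> T <#> T"
    proof
      assume "t \<otimes> x \<in> T <#> T"
      then have "s \<otimes> (t \<otimes> x) = t \<otimes> x \<otimes> s"
        using pq by (auto simp: set_mult_iff)
      then have "t \<otimes> (s \<otimes> x) = t \<otimes> (x \<otimes> s)"
        using c s t assms(3) st by (metis m_assoc)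
      then show False
        using s t c assms(3) by (metis m_closed l_cancel)
    qed
  qed
  have new': "insert (x \<otimes> x) ?N \<inter> (T <#> T) = {}"
    using new xx(2) by (auto simp: cos)
  have "card (T <#> T) + card (insert (x \<otimes> x) ?N) \<le> card (insert x T <#> insert x T)"
    by (rule card_square_insert_new[OF assms(1) _ new']) (auto simp: cos set_multI)
  then show "card (T <#> T) + card ?N + 1 \<le> card (insert x T <#> insert x T)"
    using xx(1) assms(1) by (simp add: cos)
  have "finite {t \<in> T. t \<otimes> x \<noteq> x \<otimes> t}" "{t \<in> T. t \<otimes> x \<noteq> x \<otimes> t} \<noteq> {}"
    using s assms(1) by auto
  then obtain t where t: "t \<in> T" "t \<otimes> x \<noteq> x \<otimes> t"
    and max: "\<And>u. u \<in> T \<Longrightarrow> u \<otimes> x \<noteq> x \<otimes> u \<Longrightarrow> le u t"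
    using ex_greatest[of "{t \<in> T. t \<otimes> x \<noteq> x \<otimes> t}"] by (smt (verit) mem_Collect_eq)
  have inj: "inj_on (\<lambda>t. x \<otimes> t) T" "inj_on (\<lambda>t. t \<otimes> x) T"
    using c assms(3) by (auto simp: inj_on_def)
  have up: "u \<otimes> x = x \<otimes> u" if "u \<in> T" "lt t u" for u
    using max[OF that(1)] that ord.not_le by blast
  \<comment> \<open>The element \<open>t\<close> is the greatest one not commuting with
    \<open>x\<close>. The larger of \<open>xt\<close> and \<open>tx\<close> lies in only one coset:
    written in the other one it would involve some \<open>u > t\<close>, which commutes with
    \<open>x\<close>, and cancellation would give \<open>u = t\<close>.\<close>
  have "\<exists>w\<in>?N. w \<notin> x <# T \<or> w \<notin> T #> x"
  proof (cases "lt (t \<otimes> x) (x \<otimes> t)")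
    case True
    have "x \<otimes> t \<noteq> u \<otimes> x" if u: "u \<in> T" for u
      using True up[of u] u t c assms(3) by (metis l_cancel lt_mult_right ord.less_irrefl)
    then show ?thesis
      using t by (auto simp: cos)
  next
    case False
    then have *: "lt (x \<otimes> t) (t \<otimes> x)"
      using t by (metis ord.neqE)
    have "t \<otimes> x \<noteq> x \<otimes> u" if u: "u \<in> T" for u
      using * up[of u] u t c assms(3) by (metis r_cancel lt_mult_left ord.less_irrefl)
    then show ?thesis
      using t by (auto simp: cos)
  qed
  then have "x <# T \<subset> ?N \<or> T #> x \<subset> ?N"
    by blast
  then have "card (x <# T) < card ?N \<or> card (T #> x) < card ?N"
    using assms(1) by (metis cos finite_UnI finite_imageI psubset_card_mono)
  then show "card T + 1 \<le> card ?N"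
    by (simp add: cos card_image[OF inj(1)] card_image[OF inj(2)])
qed

text \<open>If \<open>pq\<close> is at least \<open>xi\<close>, then \<open>q > i\<close>; if it is
  at least \<open>ix\<close>, then \<open>p > i\<close>. Choosing \<open>i\<close> greatest among
  the elements that fail to commute with some \<open>y\<close> makes such factors commute with
  \<open>y\<close>, so that \<open>xi = pq\<close> or \<open>ix = pq\<close> would force
  \<open>i\<close> to commute with \<open>y\<close> as well, provided that \<open>y\<close> commutes
  with \<open>x\<close> or equals it.\<close>

lemma card_square_insert_noncommuting:
  assumes "finite T" "T \<subseteq> carrier G" "x \<in> carrier G" "\<And>t. t \<in> T \<Longrightarrow> lt t x"
    and "\<not> commuting T"
  shows "card (T <#> T) + 3 \<le> card (insert x T <#> insert x T)"
proof -
  have c: "\<And>t. t \<in> T \<Longrightarrow> t \<in> carrier G"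
    using assms by auto
  have three: ?thesis if "u \<in> insert x T <#> insert x T" "v \<in> insert x T <#> insert x T"
    "w \<in> insert x T <#> insert x T" "u \<notin> T <#> T" "v \<notin> T <#> T" "w \<notin> T <#> T" "distinct [u, v, w]"
    for u v w
  proof -
    have "card (T <#> T) + card {u, v, w} \<le> card (insert x T <#> insert x T)"
      by (rule card_square_insert_new[OF assms(1)]) (use that in auto)
    then show ?thesis
      using that by simp
  qed
  have xx: "x \<otimes> x \<noteq> p \<otimes> q" if "p \<in> T" "q \<in> T" for p q
    using that assms(3,4) c lt_le_mult_mono[of p q x x] by (metis ord.less_imp_le ord.less_irrefl)
  have gt: "lt i q" if "p \<in> T" "q \<in> T" "i \<in> T" "le (x \<otimes> i) (p \<otimes> q)" for p q i
    using that assms(3,4) c lt_le_mult_mono[of p q x i] by (metis ord.not_le)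
  have gt': "lt i p" if "p \<in> T" "q \<in> T" "i \<in> T" "le (i \<otimes> x) (p \<otimes> q)" for p q i
    using that assms(3,4) c le_lt_mult_mono[of p q i x] by (metis ord.not_le)
  show ?thesis
  proof (cases "\<forall>t\<in>T. t \<otimes> x = x \<otimes> t")
    case False
    then obtain i where i: "i \<in> T" "i \<otimes> x \<noteq> x \<otimes> i"
      and max: "\<And>u. u \<in> T \<Longrightarrow> u \<otimes> x \<noteq> x \<otimes> u \<Longrightarrow> le u i"
      using ex_greatest[of "{t \<in> T. t \<otimes> x \<noteq> x \<otimes> t}"] assms(1) by (smt (verit) finite_subset
        mem_Collect_eq empty_Collect_eq subsetI)
    have up: "u \<otimes> x = x \<otimes> u" if "u \<in> T" "lt i u" for u
      using max[OF that(1)] that ord.not_le by blast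
    obtain m where m: "m \<in> T" "\<And>t. t \<in> T \<Longrightarrow> le t m"
      using ex_greatest assms(1) i by blast
    have top: "x \<otimes> m \<noteq> p \<otimes> q" "m \<otimes> x \<noteq> p \<otimes> q" if "p \<in> T" "q \<in> T" for p q
      using gt[OF that m(1)] gt'[OF that m(1)] m that by (metis ord.not_le ord.order_refl)+
    have ne: "m \<noteq> x" "i \<noteq> x"
      using m i assms(4) ord.less_irrefl by blast+
    show ?thesis
    proof (cases "m = i")
      case True
      show ?thesis
        by (rule three[of "x \<otimes> x" "x \<otimes> m" "m \<otimes> x"])
          (use m i True xx top ne c assms(3) in \<open>auto simp: set_mult_iff\<close>)
    next
      case mi: False
      have prod: False if "p \<in> T" "q \<in> T" "lt i p" "lt i q" "x \<otimes> i = p \<otimes> q \<or> i \<otimes> x = p \<otimes> q" for p q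
      proof -
        have "p \<otimes> q \<otimes> x = x \<otimes> (p \<otimes> q)"
          using up that c assms(3) by (metis m_assoc)
        then show False
          using that(5) i c assms(3) by (metis m_assoc l_cancel r_cancel m_closed)
      qed
      \<comment> \<open>The larger of the two products is taken so that an equation
        \<open>w = pq\<close> bounds both factors from below by \<open>i\<close>.\<close>
      define w where "w = (if lt (i \<otimes> x) (x \<otimes> i) then x \<otimes> i else i \<otimes> x)"
      have w: "le (x \<otimes> i) w" "le (i \<otimes> x) w" "w = x \<otimes> i \<or> w = i \<otimes> x"
        by (auto simp: w_def ord.not_less ord.less_imp_le)
      have "w \<noteq> p \<otimes> q" if "p \<in> T" "q \<in> T" for p q
        using gt[OF that i(1)] gt'[OF that i(1)] w prod[OF that] by auto
      moreover have "m \<otimes> x = x \<otimes> m"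
        using mi m i up by (metis ord.le_neq_trans)
      then have "w \<noteq> x \<otimes> m" "w \<noteq> x \<otimes> x"
        using w(3) mi i m ne c assms(3) by (metis l_cancel r_cancel)+
      ultimately show ?thesis
        by (intro three[of "x \<otimes> x" "x \<otimes> m" w])
          (use w(3) m i xx top ne c assms(3) in \<open>auto simp: set_mult_iff\<close>)
    qed
  next
    case central: True
    \<comment> \<open>Now \<open>x\<close> centralizes \<open>T\<close>, and the noncommuting pair
      is sought inside \<open>T\<close>. Factors above \<open>j\<close> commute with all of
      \<open>T\<close>, factors above \<open>i\<close> commute with \<open>j\<close>; hence neither
      \<open>xi\<close> nor \<open>xj\<close> is an old product.\<close>
    obtain j where j: "j \<in> T" "\<exists>s\<in>T. s \<otimes> j \<noteq> j \<otimes> s"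
      and jmax: "\<And>u. u \<in> T \<Longrightarrow> \<exists>s\<in>T. s \<otimes> u \<noteq> u \<otimes> s \<Longrightarrow> le u j"
      using ex_greatest[of "{t \<in> T. \<exists>s\<in>T. s \<otimes> t \<noteq> t \<otimes> s}"] assms(1,5)
      by (smt (verit) finite_subset commuting_def mem_Collect_eq empty_Collect_eq subsetI)
    obtain i where i: "i \<in> T" "i \<otimes> j \<noteq> j \<otimes> i"
      and imax: "\<And>u. u \<in> T \<Longrightarrow> u \<otimes> j \<noteq> j \<otimes> u \<Longrightarrow> le u i"
      using ex_greatest[of "{t \<in> T. t \<otimes> j \<noteq> j \<otimes> t}"] assms(1) j
      by (smt (verit) finite_subset mem_Collect_eq empty_Collect_eq subsetI)
    have jup: "u \<otimes> s = s \<otimes> u" if "u \<in> T" "lt j u" "s \<in> T" for u s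
      using jmax[OF that(1)] that ord.not_le by metis
    have iup: "u \<otimes> j = j \<otimes> u" if "u \<in> T" "lt i u" for u
      using imax[OF that(1)] that ord.not_le by blast
    have "x \<otimes> i \<noteq> p \<otimes> q" if pq: "p \<in> T" "q \<in> T" for p q
    proof
      assume eq: "x \<otimes> i = p \<otimes> q"
      then have "lt i p" "lt i q"
        using gt[OF pq i(1)] gt'[OF pq i(1)] central i by auto
      then have "p \<otimes> q \<otimes> j = j \<otimes> (p \<otimes> q)"
        using iup pq j c by (metis m_assoc)
      then have "x \<otimes> (i \<otimes> j) = x \<otimes> (j \<otimes> i)"
        using eq i j c assms(3) central by (metis m_assoc)
      then show False
        using i j c assms(3) by simp
    qed
    moreover have "x \<otimes> j \<noteq> p \<otimes> q" if pq: "p \<in> T" "q \<in> T" for p q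
    proof
      assume eq: "x \<otimes> j = p \<otimes> q"
      then have "lt j p" "lt j q"
        using gt[OF pq j(1)] gt'[OF pq j(1)] central j by auto
      then have "p \<otimes> q \<otimes> i = i \<otimes> (p \<otimes> q)"
        using jup pq i c by (metis m_assoc)
      then have "x \<otimes> (i \<otimes> j) = x \<otimes> (j \<otimes> i)"
        using eq i j c assms(3) central by (metis m_assoc)
      then show False
        using i j c assms(3) by simp
    qed
    moreover have "i \<noteq> j" "i \<noteq> x" "j \<noteq> x"
      using i j assms(4) ord.less_irrefl by blast+
    ultimately show ?thesis
      by (intro three[of "x \<otimes> x" "x \<otimes> i" "x \<otimes> j"])
        (use i j xx c assms(3) in \<open>auto simp: set_mult_iff\<close>)
  qed
qed

lemma card_square_noncommuting:
  assumes "finite S" "S \<subseteq> carrier G" "\<not> commuting S"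
  shows "3 * card S \<le> card (S <#> S) + 2"
  using assms
proof (induction S rule: ord.finite_linorder_max_induct)
  case (insert x T)
  have c: "T \<subseteq> carrier G" "x \<in> carrier G" "T \<noteq> {}"
    using insert.prems by (auto simp: commuting_def)
  have card: "card (insert x T) = card T + 1"
    using insert.hyps by (metis Suc_eq_plus1 card_insert_disjoint ord.less_irrefl)
  show ?case
  proof (cases "commuting T")
    case True
    \<comment> \<open>The count is \<open>(2|T| - 1) + (|T| + 1) + 1 = 3(|T| + 1) - 2\<close>, the
      last summand being \<open>xx\<close>.\<close>
    then show ?thesis
      using card_square_insert_commuting[OF insert.hyps(1) c(1,2) _ True insert.prems(2)]
        insert.hyps(2) card_square_ge[OF insert.hyps(1) c(1,3)] card by fastforce
  next
    case False
    then show ?thesis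
      using card_square_insert_noncommuting[OF insert.hyps(1) c(1,2) _ False]
        insert.hyps(2) insert.IH c card by fastforce
  qed
qed (simp add: commuting_def)

end

text \<open>As \<open>3 + 3 - 4 = 2\<close>, exactly two elements are shared, and they occur in the
  same order in both chains. Three choices of positions in each chain give the nine
  disjuncts.\<close>

lemma (in linorder) overlap_of_chains:
  assumes "a < b" "b < c" "x < y" "y < z" and "card ({a, b, c} \<union> {x, y, z}) = 4"
  shows "b = y \<and> c = z \<or> b = x \<and> c = z \<or> b = x \<and> c = y \<or>
    a = y \<and> c = z \<or> a = x \<and> c = z \<or> a = x \<and> c = y \<or>
    a = y \<and> b = z \<or> a = x \<and> b = z \<or> a = x \<and> b = y"
proof -
  define A B where "A = {a, b, c}" and "B = {x, y, z}"
  have "a < c" "x < z"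
    using assms by auto
  then have "card A = 3" "card B = 3"
    using assms(1-4)[THEN less_imp_neq] by (simp_all add: A_def B_def)
  moreover have "card (A \<union> B) + card (A \<inter> B) = card A + card B"
    unfolding A_def B_def by (rule card_Un_Int[symmetric]) simp_all
  ultimately have "card (A \<inter> B) = 2"
    using assms(5) by (simp add: A_def B_def)
  then obtain s t where st: "A \<inter> B = {s, t}" "s \<noteq> t"
    by (meson card_2_iff)
  have "\<exists>s t. A \<inter> B = {s, t} \<and> s < t"
  proof (cases "s < t")
    case False
    then have "A \<inter> B = {t, s}" "t < s"
      using st by auto
    then show ?thesis by blast
  qed (use st in blast)
  then obtain s t where st: "s \<in> A" "s \<in> B" "t \<in> A" "t \<in> B" "s < t"
    by blast
  then have "s = a \<and> t = b \<or> s = a \<and> t = c \<or> s = b \<and> t = c"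
    "s = x \<and> t = y \<or> s = x \<and> t = z \<or> s = y \<and> t = z"
    using assms(1-4) by (auto simp: A_def B_def)
  then show ?thesis
    by blast
qed

section \<open>Positive-word relations and change of generators\<close>

context group
begin

text \<open>The four families of the definition of a young group, with every conjugation written as a
  rewriting of positive words.\<close>

definition young_relations :: bool
  where "young_relations \<longleftrightarrow>
    (\<exists>a\<in>carrier G. \<exists>b\<in>carrier G. \<exists>w\<in>carrier G. carrier G = generate G {a, b} \<and>
      a \<otimes> b = b \<otimes> a \<otimes> w \<and> a \<otimes> w = w \<otimes> a \<and> b \<otimes> w = w \<otimes> b) \<or>
    (\<exists>a\<in>carrier G. \<exists>b\<in>carrier G. \<exists>c\<in>carrier G. carrier G = generate G {a, b, c} \<and>
      a \<otimes> b = b \<otimes> a \<and> a \<otimes> c = c \<otimes> a \<and> (c \<otimes> b = b \<otimes> c \<otimes> c \<or> c \<otimes> c \<otimes> b = b \<otimes> c) \<and> c \<noteq> \<one>) \<or>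
    (\<exists>a\<in>carrier G. \<exists>b\<in>carrier G. carrier G = generate G {a, b} \<and> a \<otimes> b = b \<otimes> a \<otimes> a \<and> a \<noteq> \<one>) \<or>
    (\<exists>a\<in>carrier G. \<exists>b\<in>carrier G. \<exists>f\<in>carrier G. carrier G = generate G {a, b} \<and>
      a \<otimes> b = b \<otimes> f \<and> f \<otimes> b = b \<otimes> a \<otimes> f \<and> a \<otimes> f = f \<otimes> a \<and> a \<noteq> \<one>)"

lemma generate_eq_carrierI:
  assumes "carrier G = generate G A" "A \<subseteq> generate G B" "B \<subseteq> carrier G"
  shows "carrier G = generate G B"
proof
  show "carrier G \<subseteq> generate G B"
    using assms by (metis generate_is_subgroup generate_subgroup_incl)
qed (use assms(3) generate_incl in blast)

lemma generate_inv: "\<lbrakk>A \<subseteq> carrier G; x \<in> generate G A\<rbrakk> \<Longrightarrow> inv x \<in> generate G A"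
  by (rule generate_m_inv_closed)

lemma generate_commute:
  assumes "A \<subseteq> carrier G" "z \<in> carrier G" "\<And>x. x \<in> A \<Longrightarrow> x \<otimes> z = z \<otimes> x" "y \<in> generate G A"
  shows "y \<otimes> z = z \<otimes> y"
  using assms(4)
proof (induction rule: generate.induct)
  case (inv h)
  then have "h \<in> carrier G" "h \<otimes> z = z \<otimes> h"
    using assms by auto
  then show ?case
    using assms(2) by (metis inv_closed inv_mult_cancel m_assoc m_closed r_inv r_one)
next
  case (eng h1 h2)
  then have "h1 \<in> carrier G" "h2 \<in> carrier G"
    using generate_incl[OF assms(1)] by auto
  then show ?case
    using eng assms(2) by (metis m_assoc)
qed (use assms in auto)

lemma commuting_generate:
  assumes "carrier G = generate G A" "z \<in> carrier G" "A \<subseteq> carrier G" "\<And>x. x \<in> A \<Longrightarrow> x \<otimes> z = z \<otimes> x"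
    and "y \<in> carrier G"
  shows "y \<otimes> z = z \<otimes> y"
  using generate_commute[OF assms(3,2,4)] assms(1,5) by simp

end

section \<open>Removing an end point, and four elements with a commuting end triple\<close>

context ordered_group
begin

lemma square_inj:
  assumes "x \<in> carrier G" "y \<in> carrier G" "x \<otimes> x = y \<otimes> y"
  shows "x = y"
proof -
  have "x [^] (2::nat) = y [^] (2::nat)"
    using assms by (simp add: numeral_2_eq_2)
  then show ?thesis
    using assms pow_inj[of x y 2] by simp
qed

text \<open>Otherwise \<open>x\<close> and \<open>y\<close> are the only noncommuting pair, and both
  centralize the rest \<open>M\<close>. Equality for \<open>S\<close> leaves at most
  \<open>2|M| + 1\<close> products for \<open>T\<close>, whereas the square of \<open>M\<close>, the
  coset \<open>yM\<close> and \<open>yy\<close> provide at least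
  \<open>(2|M| - 1) + |M| + 1\<close>. This is impossible for \<open>|M| \<ge> 2\<close>, which is
  where four elements are required.\<close>

lemma noncommuting_end:
  assumes "finite S" "S \<subseteq> carrier G" "card S \<ge> 4" "card (S <#> S) + 2 = 3 * card S"
    and "\<not> commuting S"
    and x: "x \<in> S" "\<And>t. t \<in> S \<Longrightarrow> le t x" and y: "y \<in> S" "\<And>t. t \<in> S \<Longrightarrow> le y t"
  shows "\<not> commuting (S - {x}) \<or> \<not> commuting (S - {y})"
proof (rule ccontr)
  assume "\<not> ?thesis"
  then have comm: "commuting (S - {x})" "commuting (S - {y})"
    by auto
  have "x \<noteq> y"
  proof
    assume "x = y"
    then have "S \<subseteq> {x}"
      using x y by (auto intro: ord.order_antisym)
    then show False
      using assms(3) card_mono[of "{x}" S] by simp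
  qed
  define T M where "T = S - {x}" and "M = S - {x} - {y}"
  have sets: "S = insert x T" "T = insert y M" "x \<notin> T" "y \<notin> M" "finite T" "finite M"
    "T \<subseteq> carrier G" "M \<subseteq> carrier G" "x \<in> carrier G" "y \<in> carrier G"
    using assms(1,2) x(1) y(1) \<open>x \<noteq> y\<close> by (auto simp: T_def M_def)
  have card: "card S = card M + 2" "card T = card M + 1" "card M \<ge> 2"
    using sets(3-6) assms(3) unfolding sets(1,2) by simp_all
  have less: "lt t x" if "t \<in> T" for t
    using that x(2) sets(3) by (auto simp: lt_def T_def)
  have less': "lt y t" if "t \<in> M" for t
    using that y(2) by (auto simp: lt_def M_def)
  have cT: "commuting T" "\<not> commuting (insert x T)"
    using comm(1) assms(5) sets(1) unfolding T_def by argo+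
  have "card (T <#> T) \<le> 2 * card M + 1"
    using card_square_insert_commuting[OF sets(5,7,9) less cT, folded sets(1)] assms(4) card by simp
  moreover
  have xM: "x \<otimes> m = m \<otimes> x" "y \<otimes> m = m \<otimes> y" if "m \<in> M" for m
    using that comm x(1) y(1) \<open>x \<noteq> y\<close> unfolding M_def commuting_def by blast+
  have xy: "x \<otimes> y \<noteq> y \<otimes> x"
  proof
    assume eq: "x \<otimes> y = y \<otimes> x"
    have "commuting S"
      unfolding commuting_def
    proof (intro ballI)
      fix s t assume "s \<in> S" "t \<in> S"
      then consider "s \<in> S - {x}" "t \<in> S - {x}" | "s \<in> S - {y}" "t \<in> S - {y}"
        | "s = x" "t = y" | "s = y" "t = x"
        using \<open>x \<noteq> y\<close> by blast
      then show "s \<otimes> t = t \<otimes> s"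
        by cases (use comm in \<open>simp_all only: commuting_def eq\<close>)
    qed
    then show False using assms(5) by simp
  qed
  have cM: "m \<in> carrier G" if "m \<in> M" for m
    using that sets(8) by auto
  have new1: "y \<otimes> y \<noteq> p \<otimes> q" if "p \<in> M" "q \<in> M" for p q
  proof -
    have "lt (y \<otimes> y) (p \<otimes> q)"
      using less'[OF that(1)] less'[OF that(2)] that cM sets(10)
      by (intro lt_le_mult_mono) (auto simp: lt_def)
    then show ?thesis by auto
  qed
  \<comment> \<open>The element \<open>x\<close> tells the two sets apart: it commutes with every
    product of elements of \<open>M\<close>, but not with \<open>ym\<close>.\<close>
  have new2: "y \<otimes> m \<noteq> p \<otimes> q" if "m \<in> M" "p \<in> M" "q \<in> M" for m p q
  proof
    assume eq: "y \<otimes> m = p \<otimes> q"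
    have "x \<otimes> (p \<otimes> q) = p \<otimes> q \<otimes> x"
      using xM that cM sets(9) by (metis m_assoc)
    then have "x \<otimes> (y \<otimes> m) = y \<otimes> m \<otimes> x"
      by (simp only: eq)
    then have "x \<otimes> y \<otimes> m = y \<otimes> (m \<otimes> x)"
      using cM[OF that(1)] sets(9,10) by (simp add: m_assoc)
    also have "\<dots> = y \<otimes> x \<otimes> m"
      unfolding xM(1)[OF that(1), symmetric] using cM[OF that(1)] sets(9,10) by (simp add: m_assoc)
    finally have "x \<otimes> y \<otimes> m = y \<otimes> x \<otimes> m" .
    then show False
      using xy that cM sets(9,10) by simp
  qed
  have new: "(insert (y \<otimes> y) (y <# M)) \<inter> (M <#> M) = {}"
    by (rule set_mult_disjointI) (use new1 new1[symmetric] new2 new2[symmetric] in \<open>auto simp: l_coset_def\<close>)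
  have "card (M <#> M) + card (insert (y \<otimes> y) (y <# M)) \<le> card (T <#> T)"
    unfolding sets(2)
    by (rule card_square_insert_new[OF sets(6) _ new]) (auto simp: l_coset_def set_multI)
  moreover have "card (insert (y \<otimes> y) (y <# M)) = card M + 1"
  proof -
    have im: "y <# M = (\<lambda>m. y \<otimes> m) ` M"
      by (auto simp: l_coset_def)
    moreover have "inj_on (\<lambda>m. y \<otimes> m) M"
      using cM sets(10) by (auto simp: inj_on_def)
    moreover have "y \<otimes> y \<notin> y <# M"
      using cM sets(4,10) by (auto simp: im)
    ultimately show ?thesis
      using sets(6) by (simp add: card_image)
  qed
  moreover have "M \<noteq> {}"
    using card(3) by auto
  then have "2 * card M \<le> card (M <#> M) + 1"
    using card_square_ge sets by blast
  ultimately show False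
    using card(3) by simp
qed

text \<open>The growth by at least three and the lower bound for \<open>T\<close> squeeze the
  cardinality, so exactly three products are new. As \<open>xT\<close> and \<open>xx\<close>
  together have at least four elements, some \<open>xt\<close> equals a product \<open>pq\<close> in
  \<open>T\<close>, and this expresses \<open>x\<close> through \<open>T\<close>.\<close>

lemma remove_max:
  assumes "finite T" "T \<subseteq> carrier G" "x \<in> carrier G" "\<And>t. t \<in> T \<Longrightarrow> lt t x"
    and "\<not> commuting T" "card T \<ge> 3"
    and "card (insert x T <#> insert x T) + 2 = 3 * card (insert x T)"
    and "carrier G = generate G (insert x T)"
  shows "card (T <#> T) + 2 = 3 * card T \<and> carrier G = generate G T"
proof -
  have card: "card (insert x T) = card T + 1"
    using assms(1,4) by (metis Suc_eq_plus1 card_insert_disjoint ord.less_irrefl)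
  have eq: "card (T <#> T) + 2 = 3 * card T"
    using card_square_insert_noncommuting[OF assms(1-5)] card_square_noncommuting[OF assms(1,2,5)]
      assms(7) card by simp
  have im: "x <# T = (\<lambda>m. x \<otimes> m) ` T"
    by (auto simp: l_coset_def)
  have inj: "inj_on (\<lambda>m. x \<otimes> m) T"
    using assms(2,3) by (auto simp: inj_on_def subset_iff)
  have "(x <# T) \<inter> (T <#> T) \<noteq> {}"
  proof
    assume disj: "(x <# T) \<inter> (T <#> T) = {}"
    have "card (T <#> T) + card (x <# T) \<le> card (insert x T <#> insert x T) - 1"
    proof -
      have c: "t \<in> carrier G" if "t \<in> T" for t
        using that assms(2) by auto
      have "x \<otimes> x \<noteq> p \<otimes> q" if pq: "p \<in> T" "q \<in> T" for p q
      proof -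
        have "lt (p \<otimes> q) (x \<otimes> x)"
          using assms(4)[OF pq(1)] assms(4)[OF pq(2)] pq c assms(3)
          by (intro lt_le_mult_mono) (auto simp: lt_def)
        then show ?thesis by auto
      qed
      then have "x \<otimes> x \<notin> T <#> T"
        by (auto simp: set_mult_iff)
      then have new: "(insert (x \<otimes> x) (x <# T)) \<inter> (T <#> T) = {}"
        using disj by simp
      have "card (T <#> T) + card (insert (x \<otimes> x) (x <# T)) \<le> card (insert x T <#> insert x T)"
        by (rule card_square_insert_new[OF assms(1) _ new]) (auto simp: l_coset_def set_multI)
      moreover have "x \<notin> T"
        using assms(4) ord.less_irrefl by blast
      then have "x \<otimes> x \<notin> x <# T"
        using c assms(3) by (auto simp: im)
      then have "card (insert (x \<otimes> x) (x <# T)) = card (x <# T) + 1"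
        using assms(1) by (simp add: im)
      ultimately show ?thesis by simp
    qed
    then show False
      using card assms(6,7) eq by (simp add: im card_image[OF inj])
  qed
  then obtain z where "z \<in> x <# T" "z \<in> T <#> T"
    by blast
  then obtain t p q where tpq: "t \<in> T" "p \<in> T" "q \<in> T" "x \<otimes> t = p \<otimes> q"
    unfolding im set_mult_iff by (metis imageE)
  then have "x = p \<otimes> q \<otimes> inv t"
    using assms(2,3) by (metis inv_solve_right m_closed subsetD)
  moreover have "p \<otimes> q \<otimes> inv t \<in> generate G T"
    by (intro generate.eng generate.incl generate.inv tpq(1-3))
  ultimately have "x \<in> generate G T"
    by (simp only:)
  then have "carrier G = generate G T"
    by (intro generate_eq_carrierI[OF assms(8) _ assms(2)]) (auto intro: generate.incl)
  then show ?thesis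
    using eq by simp
qed

text \<open>The triple is a progression \<open>a\<close>, \<open>aw\<close>, \<open>aww\<close>, and
  its conjugate by \<open>d\<close> is a progression \<alpha>, \<alpha>\<omega>,
  \<alpha>\<omega>\<omega> sharing exactly two terms with it. Equal steps mean a shift, which makes
  \<open>w\<close> central and the group nilpotent of class two; steps in ratio two share an end
  point, which is then fixed by \<open>d\<close>.\<close>

lemma four_commuting_initial:
  assumes c: "a \<in> carrier G" "b \<in> carrier G" "c \<in> carrier G" "d \<in> carrier G"
    and less: "lt a b" "lt b c" "lt c d"
    and "commuting {a, b, c}" "\<not> commuting {a, b, c, d}"
    and "card ({a, b, c, d} <#> {a, b, c, d}) = 10"
    and gen: "carrier G = generate G {a, b, c, d}"
  shows "young_relations"
proof -
  let ?T = "{a, b, c}"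
  have less': "lt a c" "lt a d" "lt b d"
    using less ord.less_trans by blast+
  have ins: "insert d ?T = {a, b, c, d}"
    by (simp add: insert_commute)
  have cT: "?T \<subseteq> carrier G" and ltd: "\<And>t. t \<in> ?T \<Longrightarrow> lt t d"
    using c less less' by auto
  have nc: "\<not> commuting (insert d ?T)"
    using assms(9) by (simp add: ins)
  have card3: "card ?T = 3"
    using less less' by (auto simp: lt_def)
  note C = card_square_insert_commuting[OF _ cT c(4) ltd assms(8) nc, unfolded ins card3]
  have comm: "a \<otimes> b = b \<otimes> a" "a \<otimes> c = c \<otimes> a" "b \<otimes> c = c \<otimes> b"
    using assms(8) unfolding commuting_def by blast+
  \<comment> \<open>The lower bounds 5 and 4, together with \<open>dd\<close>, already add up to 10,
    so both are attained.\<close>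
  have cards: "card (?T <#> ?T) = 5" "card ((d <# ?T) \<union> (?T #> d)) = 4"
    using C card_square_ge[OF _ cT] card3 assms(10) by simp_all
  have acbb: "a \<otimes> c = b \<otimes> b"
  proof (rule ccontr)
    assume ne: "a \<otimes> c \<noteq> b \<otimes> b"
    have lts: "lt (a \<otimes> a) (a \<otimes> b)" "lt (a \<otimes> b) (b \<otimes> b)" "lt (b \<otimes> b) (b \<otimes> c)" "lt (b \<otimes> c) (c \<otimes> c)"
      "lt (a \<otimes> b) (a \<otimes> c)" "lt (a \<otimes> c) (b \<otimes> c)"
      using c less by simp_all
    have "distinct [a \<otimes> a, a \<otimes> b, b \<otimes> b, b \<otimes> c, c \<otimes> c, a \<otimes> c]"
      using ne lts by (simp, intro conjI; order)
    then have "card {a \<otimes> a, a \<otimes> b, b \<otimes> b, b \<otimes> c, c \<otimes> c, a \<otimes> c} = 6"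
      by simp
    moreover have "{a \<otimes> a, a \<otimes> b, b \<otimes> b, b \<otimes> c, c \<otimes> c, a \<otimes> c} \<subseteq> ?T <#> ?T"
      by (simp add: set_multI)
    then have "card {a \<otimes> a, a \<otimes> b, b \<otimes> b, b \<otimes> c, c \<otimes> c, a \<otimes> c} \<le> card (?T <#> ?T)"
      by (intro card_mono set_mult_finite) simp_all
    ultimately show False
      using cards(1) by simp
  qed
  define w \<alpha> \<omega> where "w = inv a \<otimes> b" and "\<alpha> = inv d \<otimes> a \<otimes> d" and "\<omega> = inv d \<otimes> w \<otimes> d"
  have cw: "w \<in> carrier G" "\<alpha> \<in> carrier G" "\<omega> \<in> carrier G"
    using c by (simp_all add: w_def \<alpha>_def \<omega>_def)
  have b: "b = a \<otimes> w"
    using c by (simp add: w_def)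
  have aw: "w \<otimes> a = a \<otimes> w"
    using comm(1) c(1) cw(1) by (simp add: b m_assoc)
  have aw': "w \<otimes> (a \<otimes> z) = a \<otimes> (w \<otimes> z)" if "z \<in> carrier G" for z
    using aw c(1) cw(1) that by (metis m_assoc)
  have c': "c = a \<otimes> (w \<otimes> w)"
    using acbb c(1,3) cw(1) by (simp add: b m_assoc aw')
  have "w \<noteq> \<one>"
    using less(1) c(1) by (auto simp: b)
  have ad: "a \<otimes> d = d \<otimes> \<alpha>" and wd: "w \<otimes> d = d \<otimes> \<omega>"
    using c cw(1) by (simp_all add: \<alpha>_def \<omega>_def m_assoc)
  have bd: "b \<otimes> d = d \<otimes> (\<alpha> \<otimes> \<omega>)" and cd: "c \<otimes> d = d \<otimes> (\<alpha> \<otimes> (\<omega> \<otimes> \<omega>))"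
    using c(1,4) cw ad wd by (simp_all add: b c' m_assoc) (metis m_assoc m_closed)+
  have nontriv: "\<not> (\<alpha> = a \<and> \<omega> = w)"
  proof
    assume "\<alpha> = a \<and> \<omega> = w"
    then have "a \<otimes> d = d \<otimes> a" "b \<otimes> d = d \<otimes> b" "c \<otimes> d = d \<otimes> c"
      using ad bd cd by (simp_all add: b c')
    then show False
      using comm assms(9) unfolding commuting_def by (metis insertE emptyE)
  qed
  \<comment> \<open>Cancelling \<open>d\<close> on the left turns the cosets \<open>dT\<close> and
    \<open>Td\<close> into the triple and its conjugate, without changing the size of their
    union.\<close>
  define A B where "A = {a, b, c}" and "B = {\<alpha>, \<alpha> \<otimes> \<omega>, \<alpha> \<otimes> (\<omega> \<otimes> \<omega>)}"
  have AB: "A \<subseteq> carrier G" "B \<subseteq> carrier G"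
    using c cw by (auto simp: A_def B_def)
  have "d <# ?T = (\<lambda>t. d \<otimes> t) ` A" "?T #> d = (\<lambda>t. d \<otimes> t) ` B"
    by (auto simp: l_coset_def r_coset_def A_def B_def ad bd cd)
  then have "card ((\<lambda>t. d \<otimes> t) ` (A \<union> B)) = 4"
    using cards(2) by (simp add: image_Un)
  moreover have "inj_on (\<lambda>t. d \<otimes> t) (A \<union> B)"
    using AB c(4) unfolding inj_on_def by (meson Un_least l_cancel subsetD)
  ultimately have AB4: "card (A \<union> B) = 4"
    by (simp add: card_image)
  have "lt (d \<otimes> \<alpha>) (d \<otimes> (\<alpha> \<otimes> \<omega>))" "lt (d \<otimes> (\<alpha> \<otimes> \<omega>)) (d \<otimes> (\<alpha> \<otimes> (\<omega> \<otimes> \<omega>)))"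
    unfolding ad[symmetric] bd[symmetric] cd[symmetric] using less c by simp_all
  then have "lt \<alpha> (\<alpha> \<otimes> \<omega>)" "lt (\<alpha> \<otimes> \<omega>) (\<alpha> \<otimes> (\<omega> \<otimes> \<omega>))"
    using c cw by simp_all
  note lts = this less(1,2)
  have cases:
    "b = \<alpha> \<otimes> \<omega> \<and> c = \<alpha> \<otimes> (\<omega> \<otimes> \<omega>) \<or> b = \<alpha> \<and> c = \<alpha> \<otimes> (\<omega> \<otimes> \<omega>) \<or> b = \<alpha> \<and> c = \<alpha> \<otimes> \<omega> \<or>
     a = \<alpha> \<otimes> \<omega> \<and> c = \<alpha> \<otimes> (\<omega> \<otimes> \<omega>) \<or> a = \<alpha> \<and> c = \<alpha> \<otimes> (\<omega> \<otimes> \<omega>) \<or> a = \<alpha> \<and> c = \<alpha> \<otimes> \<omega> \<or>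
     a = \<alpha> \<otimes> \<omega> \<and> b = \<alpha> \<otimes> (\<omega> \<otimes> \<omega>) \<or> a = \<alpha> \<and> b = \<alpha> \<otimes> (\<omega> \<otimes> \<omega>) \<or> a = \<alpha> \<and> b = \<alpha> \<otimes> \<omega>"
    using ord.overlap_of_chains[OF less(1,2) lts(1,2)] AB4 unfolding A_def B_def .
  have nontriv': "\<omega> \<noteq> w" if "\<alpha> = a"
    using nontriv that by simp
  \<comment> \<open>Shift by one place: \<open>w\<close> commutes with \<open>a\<close> and
    \<open>d\<close>, and the commutator of \<open>a\<close> and \<open>d\<close> is
    \<open>w\<close> or its inverse.\<close>
  have P: "young_relations" if \<omega>: "\<omega> = w" and \<alpha>: "\<exists>w'\<in>{w, inv w}. \<alpha> = a \<otimes> w'"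
  proof -
    obtain w' where w': "w' \<in> {w, inv w}" "\<alpha> = a \<otimes> w'"
      using \<alpha> by blast
    have cw': "w' \<in> carrier G"
      using w'(1) cw(1) by auto
    have g: "a \<in> generate G {a, d}" "d \<in> generate G {a, d}"
      by (auto intro: generate.incl)
    have "w' = inv a \<otimes> (inv d \<otimes> (a \<otimes> d))"
      using ad c cw' by (simp add: w'(2) m_assoc)
    also have "\<dots> \<in> generate G {a, d}"
      using g c by (intro generate.eng generate_inv) auto
    finally have gw: "w' \<in> generate G {a, d}" .
    then have "w \<in> generate G {a, d}"
      using w'(1) generate_inv[OF _ gw] c cw(1) by auto
    then have "carrier G = generate G {a, d}"
      using g c by (intro generate_eq_carrierI[OF gen]) (auto simp: b c' intro!: generate.eng)
    moreover have "w \<otimes> a = a \<otimes> w" "w \<otimes> d = d \<otimes> w"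
      using aw wd \<omega> by auto
    then have "a \<otimes> w' = w' \<otimes> a" "d \<otimes> w' = w' \<otimes> d"
      using w'(1) c cw(1) by (metis insertE emptyE inv_closed inv_solve_left inv_solve_right m_assoc m_closed)+
    moreover have "a \<otimes> d = d \<otimes> a \<otimes> w'"
      using ad w'(2) c cw' by (simp add: m_assoc)
    ultimately show ?thesis
      using c cw' unfolding young_relations_def by blast
  qed
  \<comment> \<open>The fixed end point \<open>p\<close> commutes with \<open>d\<close> and
    \<open>w\<close> and becomes the direct factor, while \<open>d\<close> acts on \<open>w\<close>
    by squaring or by taking the square root.\<close>
  have Q: "young_relations" if \<omega>: "w = \<omega> \<otimes> \<omega> \<or> \<omega> = w \<otimes> w" and p: "p \<in> {a, c}" "p \<otimes> d = d \<otimes> p" for p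
  proof -
    have "p \<in> carrier G" "p \<otimes> w = w \<otimes> p"
      using p(1) c cw(1) by (auto simp: c' m_assoc aw aw')
    moreover have "w \<otimes> d = d \<otimes> w \<otimes> w \<or> w \<otimes> w \<otimes> d = d \<otimes> w"
    proof (rule disjE[OF \<omega>])
      assume *: "w = \<omega> \<otimes> \<omega>"
      have "w \<otimes> w \<otimes> d = w \<otimes> (d \<otimes> \<omega>)"
        using wd c(4) cw by (simp add: m_assoc)
      also have "\<dots> = d \<otimes> (\<omega> \<otimes> \<omega>)"
        using wd c(4) cw by (metis m_assoc)
      finally show ?thesis
        using * by simp
    next
      assume "\<omega> = w \<otimes> w"
      then show ?thesis
        using wd c(4) cw by (simp add: m_assoc)
    qed
    moreover have "carrier G = generate G {p, d, w}"
    proof (rule generate_eq_carrierI[OF gen])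
      have g: "p \<in> generate G {p, d, w}" "d \<in> generate G {p, d, w}" "w \<in> generate G {p, d, w}"
        by (auto intro: generate.incl)
      have "a = p \<or> a = p \<otimes> (inv w \<otimes> inv w)"
        using p(1) c(1) cw(1) by (auto simp: c' m_assoc)
      then have "a \<in> generate G {p, d, w}"
        using g c cw \<open>p \<in> carrier G\<close> by (auto intro!: generate.eng generate_inv)
      then show "{a, b, c, d} \<subseteq> generate G {p, d, w}"
        using g by (auto simp: b c' intro!: generate.eng)
    qed (use c cw \<open>p \<in> carrier G\<close> in auto)
    ultimately show ?thesis
      using c cw \<open>w \<noteq> \<one>\<close> p(2) unfolding young_relations_def by blast
  qed
  from cases show ?thesis
    unfolding b c'
  proof (elim disjE conjE)
    assume *: "a \<otimes> w = \<alpha> \<otimes> \<omega>" "a \<otimes> (w \<otimes> w) = \<alpha> \<otimes> (\<omega> \<otimes> \<omega>)"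
    from *(2) have "a \<otimes> w \<otimes> w = \<alpha> \<otimes> \<omega> \<otimes> \<omega>"
      using c cw by (simp add: m_assoc)
    then have "a \<otimes> w \<otimes> w = a \<otimes> w \<otimes> \<omega>"
      unfolding *(1) .
    then have "\<omega> = w"
      using c(1) cw by simp
    then show ?thesis
      using * nontriv c cw by auto
  next
    assume *: "a \<otimes> w = \<alpha>" "a \<otimes> (w \<otimes> w) = \<alpha> \<otimes> (\<omega> \<otimes> \<omega>)"
    then have "w = \<omega> \<otimes> \<omega>"
      using c(1) cw by (auto simp: m_assoc simp flip: *(1))
    then show ?thesis
      using * cd c' Q[of c] by simp
  next
    assume *: "a \<otimes> w = \<alpha>" "a \<otimes> (w \<otimes> w) = \<alpha> \<otimes> \<omega>"
    then have "\<omega> = w"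
      using c(1) cw by (auto simp: m_assoc simp flip: *(1))
    then show ?thesis
      using * P by auto
  next
    assume *: "a = \<alpha> \<otimes> \<omega>" "a \<otimes> (w \<otimes> w) = \<alpha> \<otimes> (\<omega> \<otimes> \<omega>)"
    then have "a \<otimes> (w \<otimes> w) = a \<otimes> \<omega>"
      using cw by (simp add: m_assoc)
    then have "\<omega> = w \<otimes> w"
      using c(1) cw by simp
    then show ?thesis
      using * cd c' Q[of c] by simp
  next
    assume *: "a = \<alpha>" "a \<otimes> (w \<otimes> w) = \<alpha> \<otimes> (\<omega> \<otimes> \<omega>)"
    then have "w \<otimes> w = \<omega> \<otimes> \<omega>"
      using c(1) cw by (auto simp flip: *(1))
    then show ?thesis
      using nontriv'[OF *(1)[symmetric]] square_inj[OF cw(1,3)] by simp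
  next
    assume *: "a = \<alpha>" "a \<otimes> (w \<otimes> w) = \<alpha> \<otimes> \<omega>"
    then have "\<omega> = w \<otimes> w"
      using c(1) cw by (auto simp flip: *(1))
    then show ?thesis
      using * ad Q[of a] by simp
  next
    assume *: "a = \<alpha> \<otimes> \<omega>" "a \<otimes> w = \<alpha> \<otimes> (\<omega> \<otimes> \<omega>)"
    then have "a \<otimes> w = a \<otimes> \<omega>"
      using cw by (simp add: m_assoc)
    then have "\<omega> = w"
      using c(1) cw by simp
    moreover have "\<alpha> = a \<otimes> inv w"
      unfolding *(1) \<open>\<omega> = w\<close> using cw by (simp add: m_assoc)
    ultimately show ?thesis
      by (intro P) blast+
  next
    assume *: "a = \<alpha>" "a \<otimes> w = \<alpha> \<otimes> (\<omega> \<otimes> \<omega>)"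
    then have "w = \<omega> \<otimes> \<omega>"
      using c(1) cw by (auto simp flip: *(1))
    then show ?thesis
      using * ad Q[of a] by simp
  next
    assume *: "a = \<alpha>" "a \<otimes> w = \<alpha> \<otimes> \<omega>"
    then show ?thesis
      using nontriv' c(1) cw by (auto simp flip: *(1))
  qed
qed

end

subsection \<open>Three and four elements\<close>

context ordered_group
begin

text \<open>The products \<open>xy\<close>, \<open>yx\<close> lie strictly between \<open>xx\<close>
  and \<open>yy\<close>, and \<open>yz\<close>, \<open>zy\<close> strictly between \<open>yy\<close>
  and \<open>zz\<close>. Hence the seven listed products are distinct and exhaust the square;
  monotonicity leaves three places for each of \<open>xz\<close> and \<open>zx\<close>.\<close>

lemma three_chain_square:
  assumes c: "x \<in> carrier G" "y \<in> carrier G" "z \<in> carrier G"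
    and less: "lt x y" "lt y z"
    and "x \<otimes> y \<noteq> y \<otimes> x" "y \<otimes> z \<noteq> z \<otimes> y" "card ({x, y, z} <#> {x, y, z}) = 7"
  shows "{x, y, z} <#> {x, y, z} =
    {x \<otimes> x, x \<otimes> y, y \<otimes> x, y \<otimes> y, y \<otimes> z, z \<otimes> y, z \<otimes> z}"
    and "x \<otimes> z = y \<otimes> x \<or> x \<otimes> z = y \<otimes> y \<or> x \<otimes> z = z \<otimes> y"
    and "z \<otimes> x = x \<otimes> y \<or> z \<otimes> x = y \<otimes> y \<or> z \<otimes> x = y \<otimes> z"
proof -
  let ?L = "[x \<otimes> x, x \<otimes> y, y \<otimes> x, y \<otimes> y, y \<otimes> z, z \<otimes> y, z \<otimes> z]"
  have lts: "lt (x \<otimes> x) (x \<otimes> y)" "lt (x \<otimes> x) (y \<otimes> x)" "lt (x \<otimes> y) (y \<otimes> y)" "lt (y \<otimes> x) (y \<otimes> y)"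
    "lt (y \<otimes> y) (y \<otimes> z)" "lt (y \<otimes> y) (z \<otimes> y)" "lt (y \<otimes> z) (z \<otimes> z)" "lt (z \<otimes> y) (z \<otimes> z)"
    "lt (x \<otimes> y) (x \<otimes> z)" "lt (x \<otimes> z) (y \<otimes> z)" "lt (y \<otimes> x) (z \<otimes> x)" "lt (z \<otimes> x) (z \<otimes> y)"
    using c less by simp_all
  have "distinct ?L"
    using lts assms(6,7) by (simp, intro conjI; order)
  then have "card (set ?L) = 7"
    using distinct_card by fastforce
  moreover have "set ?L \<subseteq> {x, y, z} <#> {x, y, z}"
    by (simp add: set_multI)
  ultimately have eq: "set ?L = {x, y, z} <#> {x, y, z}"
    using assms(8) by (intro card_subset_eq set_mult_finite) simp_all
  then show "{x, y, z} <#> {x, y, z} =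
    {x \<otimes> x, x \<otimes> y, y \<otimes> x, y \<otimes> y, y \<otimes> z, z \<otimes> y, z \<otimes> z}"
    by simp
  have "x \<otimes> z \<in> set ?L" "z \<otimes> x \<in> set ?L"
    unfolding eq by (simp_all add: set_multI)
  moreover have "x \<otimes> z \<noteq> x \<otimes> x" "x \<otimes> z \<noteq> x \<otimes> y" "x \<otimes> z \<noteq> y \<otimes> z" "x \<otimes> z \<noteq> z \<otimes> z"
    "z \<otimes> x \<noteq> x \<otimes> x" "z \<otimes> x \<noteq> y \<otimes> x" "z \<otimes> x \<noteq> z \<otimes> y" "z \<otimes> x \<noteq> z \<otimes> z"
    using lts by order+
  ultimately show "x \<otimes> z = y \<otimes> x \<or> x \<otimes> z = y \<otimes> y \<or> x \<otimes> z = z \<otimes> y"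
    and "z \<otimes> x = x \<otimes> y \<or> z \<otimes> x = y \<otimes> y \<or> z \<otimes> x = y \<otimes> z"
    by simp_all
qed

text \<open>Three of the nine combinations are contradictory, because \<open>xx\<close> would
  commute with \<open>z\<close>, \<open>yy\<close> with \<open>x\<close>, or \<open>zz\<close> with
  \<open>x\<close>, and uniqueness of roots would remove the square.\<close>

lemma three_chain_types:
  assumes c: "x \<in> carrier G" "y \<in> carrier G" "z \<in> carrier G"
    and less: "lt x y" "lt y z"
    and nc: "x \<otimes> y \<noteq> y \<otimes> x" "y \<otimes> z \<noteq> z \<otimes> y"
    and "card ({x, y, z} <#> {x, y, z}) = 7"
  shows "x \<otimes> z = y \<otimes> x \<and> z \<otimes> x = y \<otimes> z \<or> x \<otimes> z = z \<otimes> y \<and> z \<otimes> x = x \<otimes> y \<or>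
    x \<otimes> z = y \<otimes> x \<and> z \<otimes> x = y \<otimes> y \<or> x \<otimes> z = y \<otimes> y \<and> z \<otimes> x = x \<otimes> y \<or>
    x \<otimes> z = y \<otimes> y \<and> z \<otimes> x = y \<otimes> z \<or> x \<otimes> z = z \<otimes> y \<and> z \<otimes> x = y \<otimes> y"
proof -
  have False if "x \<otimes> z = y \<otimes> x" "z \<otimes> x = x \<otimes> y"
  proof -
    have "x \<otimes> x \<otimes> z = x \<otimes> (y \<otimes> x)"
      unfolding that(1)[symmetric] using c by (simp add: m_assoc)
    also have "\<dots> = z \<otimes> x \<otimes> x"
      unfolding that(2) using c by (simp add: m_assoc)
    finally have "x \<otimes> x \<otimes> z = z \<otimes> (x \<otimes> x)"
      using c by (simp add: m_assoc)
    then have "x \<otimes> z = z \<otimes> x"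
      by (rule square_commute_imp_commute[OF c(1,3)])
    then show False
      using that nc by simp
  qed
  moreover have False if "x \<otimes> z = y \<otimes> y" "z \<otimes> x = y \<otimes> y"
  proof -
    have "x \<otimes> z \<otimes> x = x \<otimes> (z \<otimes> x)"
      using c by (simp add: m_assoc)
    then have "y \<otimes> y \<otimes> x = x \<otimes> (y \<otimes> y)"
      unfolding that .
    then show False
      using nc(1) square_commute_imp_commute[OF c(2,1)] by simp
  qed
  moreover have False if "x \<otimes> z = z \<otimes> y" "z \<otimes> x = y \<otimes> z"
  proof -
    have "z \<otimes> z \<otimes> x = z \<otimes> (y \<otimes> z)"
      unfolding that(2)[symmetric] using c by (simp add: m_assoc)
    also have "\<dots> = x \<otimes> z \<otimes> z"
      unfolding that(1) using c by (simp add: m_assoc)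
    finally have "z \<otimes> z \<otimes> x = x \<otimes> (z \<otimes> z)"
      using c by (simp add: m_assoc)
    then have "z \<otimes> x = x \<otimes> z"
      by (rule square_commute_imp_commute[OF c(3,1)])
    then show False
      using that nc by simp
  qed
  ultimately show ?thesis
    using three_chain_square(2,3)[OF assms] by blast
qed

text \<open>Without either coincidence there would be eight distinct products. Neither
  \<open>xz\<close> nor \<open>zx\<close> can be \<open>yy\<close>, since \<open>x\<close> commutes
  with \<open>yy\<close> but not with \<open>z\<close>.\<close>

lemma three_chain_commuting_pair:
  assumes c: "x \<in> carrier G" "y \<in> carrier G" "z \<in> carrier G"
    and less: "lt x y" "lt y z"
    and comm: "x \<otimes> y = y \<otimes> x" and nc: "x \<otimes> z \<noteq> z \<otimes> x" "y \<otimes> z \<noteq> z \<otimes> y"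
    and card: "card ({x, y, z} <#> {x, y, z}) = 7"
  shows "x \<otimes> z = z \<otimes> y \<or> z \<otimes> x = y \<otimes> z"
proof (rule ccontr)
  assume neg: "\<not> ?thesis"
  let ?L = "[x \<otimes> x, x \<otimes> y, y \<otimes> y, x \<otimes> z, z \<otimes> x, y \<otimes> z, z \<otimes> y, z \<otimes> z]"
  have lts: "lt (x \<otimes> x) (x \<otimes> y)" "lt (x \<otimes> y) (y \<otimes> y)"
    "lt (y \<otimes> y) (y \<otimes> z)" "lt (y \<otimes> y) (z \<otimes> y)" "lt (y \<otimes> z) (z \<otimes> z)" "lt (z \<otimes> y) (z \<otimes> z)"
    "lt (x \<otimes> y) (x \<otimes> z)" "lt (x \<otimes> z) (y \<otimes> z)" "lt (y \<otimes> x) (z \<otimes> x)" "lt (z \<otimes> x) (z \<otimes> y)"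
    using c less by simp_all
  have ne: "x \<otimes> z \<noteq> y \<otimes> y" "z \<otimes> x \<noteq> y \<otimes> y"
  proof -
    have yyx: "y \<otimes> y \<otimes> x = x \<otimes> (y \<otimes> y)"
      using c comm by (metis m_assoc)
    show "x \<otimes> z \<noteq> y \<otimes> y"
    proof
      assume "x \<otimes> z = y \<otimes> y"
      then have "x \<otimes> z \<otimes> x = x \<otimes> (x \<otimes> z)"
        using yyx by simp
      then have "x \<otimes> (z \<otimes> x) = x \<otimes> (x \<otimes> z)"
        using c by (simp add: m_assoc)
      then show False using nc(1) c by simp
    qed
    show "z \<otimes> x \<noteq> y \<otimes> y"
    proof
      assume "z \<otimes> x = y \<otimes> y"
      then have "x \<otimes> (z \<otimes> x) = z \<otimes> x \<otimes> x"
        using yyx by simp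
      then have "x \<otimes> z \<otimes> x = z \<otimes> x \<otimes> x"
        using c by (simp add: m_assoc)
      then show False using nc(1) c by simp
    qed
  qed
  have "distinct ?L"
    using lts nc neg ne comm by (simp, intro conjI; order)
  then have "card (set ?L) = 8"
    using distinct_card by fastforce
  moreover have "card (set ?L) \<le> card ({x, y, z} <#> {x, y, z})"
    by (intro card_mono set_mult_finite) (simp_all add: set_multI)
  ultimately show False
    using card by simp
qed

text \<open>Conjugation by \<open>x\<close> acts on the commuting pair by the Fibonacci matrix:
  \<open>e\<close> goes to \<open>f\<close> and \<open>f\<close> to \<open>fe\<close>. This is
  family (iv), with \<open>f\<close> as the conjugate of its first generator.\<close>

lemma fibonacci_young:
  assumes c: "x \<in> carrier G" "e \<in> carrier G" "f \<in> carrier G"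
    and "e \<otimes> x = x \<otimes> f" "f \<otimes> x = x \<otimes> (f \<otimes> e)" "e \<otimes> f = f \<otimes> e" "e \<noteq> \<one>"
    and "carrier G = generate G A" "A \<subseteq> generate G {e, x}"
  shows "young_relations"
proof -
  have "carrier G = generate G {e, x}"
    by (rule generate_eq_carrierI[OF assms(8,9)]) (use c in auto)
  moreover have "f \<otimes> x = x \<otimes> e \<otimes> f"
    using assms(5,6) c by (simp add: m_assoc)
  ultimately show ?thesis
    using assms c unfolding young_relations_def by blast
qed

text \<open>One equation exhibits \<open>y\<close> as a conjugate of \<open>z\<close> and eliminates
  it. In terms of the quotient \<open>w\<close> of \<open>z\<close> and \<open>x\<close> the other
  one says that conjugation by \<open>x\<close>, or by its inverse, squares
  \<open>w\<close>.\<close>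

lemma baumslag_solitar_young:
  assumes c: "x \<in> carrier G" "y \<in> carrier G" "z \<in> carrier G"
    and gen: "carrier G = generate G {x, y, z}" and "x \<noteq> z"
    and "x \<otimes> z = y \<otimes> x \<and> z \<otimes> x = y \<otimes> z \<or> x \<otimes> z = z \<otimes> y \<and> z \<otimes> x = x \<otimes> y"
  shows "young_relations"
  using assms(6)
proof (elim disjE conjE)
  assume eq: "x \<otimes> z = y \<otimes> x" "z \<otimes> x = y \<otimes> z"
  define w where "w = inv x \<otimes> z"
  have w: "w \<in> carrier G" "z = x \<otimes> w" "w \<noteq> \<one>"
    using c \<open>x \<noteq> z\<close> by (auto simp: w_def) (metis mult_inv_cancel r_one)
  have y: "y = x \<otimes> z \<otimes> inv x"
    using eq(1) c by (metis inv_solve_right m_closed)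
  have "x \<otimes> (w \<otimes> x) = x \<otimes> (x \<otimes> (w \<otimes> w))"
    using eq(2) c w(1) unfolding y w(2) by (simp add: m_assoc)
  then have "w \<otimes> x = x \<otimes> w \<otimes> w"
    using c w(1) by (simp add: m_assoc)
  moreover have "{x, y, z} \<subseteq> generate G {w, x}"
    unfolding y w(2) by (auto intro!: generate.eng intro: generate.incl generate.inv)
  then have "carrier G = generate G {w, x}"
    by (rule generate_eq_carrierI[OF gen]) (use c w in auto)
  ultimately show ?thesis
    using c w unfolding young_relations_def by blast
next
  assume eq: "x \<otimes> z = z \<otimes> y" "z \<otimes> x = x \<otimes> y"
  define w where "w = z \<otimes> inv x"
  have w: "w \<in> carrier G" "z = w \<otimes> x" "w \<noteq> \<one>"
    using c \<open>x \<noteq> z\<close> by (auto simp: w_def m_assoc dest: inv_equality)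
  have y: "y = inv x \<otimes> (z \<otimes> x)"
    using eq(2) c by simp
  have "x \<otimes> w \<otimes> x = w \<otimes> w \<otimes> x \<otimes> x"
    using eq(1) c w(1) unfolding y w(2) by (simp add: m_assoc)
  then have "x \<otimes> w = w \<otimes> w \<otimes> x"
    using c w(1) by (metis m_closed r_cancel)
  then have "inv x \<otimes> (x \<otimes> w) \<otimes> inv x = inv x \<otimes> (w \<otimes> w \<otimes> x) \<otimes> inv x"
    by simp
  then have "w \<otimes> inv x = inv x \<otimes> w \<otimes> w"
    using c w(1) by (simp add: m_assoc)
  moreover have "inv (inv x) \<in> generate G {w, inv x}"
    by (rule generate.inv) simp
  then have "x \<in> generate G {w, inv x}"
    using c by simp
  then have "{x, y, z} \<subseteq> generate G {w, inv x}"
    unfolding y w(2) by (auto intro!: generate.eng intro: generate.incl)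
  then have "carrier G = generate G {w, inv x}"
    by (rule generate_eq_carrierI[OF gen]) (use c w in auto)
  moreover have "inv x \<in> carrier G"
    using c by simp
  ultimately show ?thesis
    using w unfolding young_relations_def by blast
qed

end

section \<open>Four elements both of whose consecutive triples are noncommuting\<close>

locale four_chain = ordered_group +
  fixes a b c d
  assumes carr [simp]: "a \<in> carrier G" "b \<in> carrier G" "c \<in> carrier G" "d \<in> carrier G"
    and less: "lt a b" "lt b c" "lt c d"
    and abc: "\<not> commuting {a, b, c}" and bcd: "\<not> commuting {b, c, d}"
    and card_square: "card ({a, b, c, d} <#> {a, b, c, d}) = 10"
    and gen: "carrier G = generate G {a, b, c, d}"
begin

lemma less': "lt a c" "lt a d" "lt b d"
  using less by order+

text \<open>Exchanges \<open>a\<close> with \<open>d\<close> and \<open>b\<close> with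
  \<open>c\<close> while leaving the order of factors in a product alone.\<close>

lemma four_chain_converse: "four_chain G (r\<inverse>) d c b a"
proof (intro four_chain.intro four_chain_axioms.intro ordered_group_converse)
  have *: "{d, c, b, a} = {a, b, c, d}" and **: "{d, c, b} = {b, c, d}" "{c, b, a} = {a, b, c}"
    by auto
  show "\<not> commuting {d, c, b}" "\<not> commuting {c, b, a}"
    unfolding ** by (fact bcd abc)+
  show "card ({d, c, b, a} <#> {d, c, b, a}) = 10" "carrier G = generate G {d, c, b, a}"
    unfolding * by (fact card_square gen)+
qed (use less in \<open>simp_all add: lt_converse\<close>)

text \<open>Inversion reverses the order and the products, so combined with \<open>r\<inverse>\<close> it only exchanges \<open>xy\<close>
  with \<open>yx\<close>.\<close>

lemma four_chain_inv: "four_chain G (r\<inverse>) (inv a) (inv b) (inv c) (inv d)"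
proof (intro four_chain.intro four_chain_axioms.intro ordered_group_converse)
  have comm: "x \<otimes> y = y \<otimes> x" if "inv x \<otimes> inv y = inv y \<otimes> inv x" "x \<in> carrier G" "y \<in> carrier G"
    for x y
  proof -
    have "inv (y \<otimes> x) = inv (x \<otimes> y)"
      using that by (simp add: inv_mult_group)
    then show ?thesis
      using that by (metis inv_inv m_closed)
  qed
  show "\<not> commuting {inv a, inv b, inv c}"
    using abc comm[of a b] comm[of a c] comm[of b c] unfolding commuting_def
    by (metis carr insertE insertI1 insert_iff emptyE)
  show "\<not> commuting {inv b, inv c, inv d}"
    using bcd comm[of b c] comm[of b d] comm[of c d] unfolding commuting_def
    by (metis carr insertE insertI1 insert_iff emptyE)
  have "{inv a, inv b, inv c, inv d} <#> {inv a, inv b, inv c, inv d} =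
      (\<lambda>x. inv x) ` ({a, b, c, d} <#> {a, b, c, d})"
    by (auto simp: set_mult_def inv_mult_group)
  moreover have "inj_on (\<lambda>x. inv x) ({a, b, c, d} <#> {a, b, c, d})"
    by (rule inj_on_subset[OF inv_inj]) (auto simp: set_mult_iff)
  ultimately show "card ({inv a, inv b, inv c, inv d} <#> {inv a, inv b, inv c, inv d}) = 10"
    using card_square by (simp add: card_image)
  have "x \<in> generate G {inv a, inv b, inv c, inv d}" if "x \<in> {a, b, c, d}" for x
    using that generate.inv[of "inv x" "{inv a, inv b, inv c, inv d}" G] by auto
  then have "{a, b, c, d} \<subseteq> generate G {inv a, inv b, inv c, inv d}"
    by (rule subsetI)
  then show "carrier G = generate G {inv a, inv b, inv c, inv d}"
    by (intro generate_eq_carrierI[OF gen]) auto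
qed (use less in \<open>simp_all add: lt_converse lt_inv\<close>)

lemma initial: "card ({a, b, c} <#> {a, b, c}) = 7" "carrier G = generate G {a, b, c}"
proof -
  have "card {a, b, c} = 3" "card {d, a, b, c} = 4"
    using less less' by (auto simp: lt_def)
  moreover have ins: "{a, b, c, d} = insert d {a, b, c}"
    by auto
  moreover have "lt t d" if "t \<in> {a, b, c}" for t
    using that less less' by auto
  note R = remove_max[OF _ _ carr(4) this abc _ _ gen[unfolded ins]]
  have "card ({a, b, c} <#> {a, b, c}) + 2 = 3 * card {a, b, c} \<and> carrier G = generate G {a, b, c}"
    by (rule R) (use calculation card_square[unfolded ins] in simp_all)
  ultimately show "card ({a, b, c} <#> {a, b, c}) = 7" "carrier G = generate G {a, b, c}"
    by simp_all
qed

lemma final: "card ({b, c, d} <#> {b, c, d}) = 7" "carrier G = generate G {b, c, d}"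
proof -
  interpret C: four_chain G "r\<inverse>" d c b a
    by (rule four_chain_converse)
  have *: "{d, c, b} = {b, c, d}"
    by (simp add: insert_commute)
  show "card ({b, c, d} <#> {b, c, d}) = 7" "carrier G = generate G {b, c, d}"
    using C.initial unfolding * by this+
qed

end

lemma three_square_iff:
  "t \<in> {x, y, z} <#>\<^bsub>G\<^esub> {x, y, z} \<longleftrightarrow>
    t = x \<otimes>\<^bsub>G\<^esub> x \<or> t = x \<otimes>\<^bsub>G\<^esub> y \<or> t = x \<otimes>\<^bsub>G\<^esub> z \<or> t = y \<otimes>\<^bsub>G\<^esub> x \<or> t = y \<otimes>\<^bsub>G\<^esub> y \<or>
    t = y \<otimes>\<^bsub>G\<^esub> z \<or> t = z \<otimes>\<^bsub>G\<^esub> x \<or> t = z \<otimes>\<^bsub>G\<^esub> y \<or> t = z \<otimes>\<^bsub>G\<^esub> z"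
  by (auto simp: set_mult_def)

context four_chain
begin

lemma products_less:
  "lt (a \<otimes> a) (a \<otimes> b)" "lt (a \<otimes> a) (b \<otimes> a)" "lt (a \<otimes> b) (b \<otimes> b)" "lt (b \<otimes> a) (b \<otimes> b)"
  "lt (a \<otimes> b) (a \<otimes> c)" "lt (b \<otimes> a) (c \<otimes> a)" "lt (a \<otimes> c) (b \<otimes> c)" "lt (c \<otimes> a) (c \<otimes> b)"
  "lt (b \<otimes> b) (b \<otimes> c)" "lt (b \<otimes> b) (c \<otimes> b)" "lt (b \<otimes> c) (c \<otimes> c)" "lt (c \<otimes> b) (c \<otimes> c)"
  "lt (a \<otimes> c) (a \<otimes> d)" "lt (c \<otimes> a) (d \<otimes> a)" "lt (a \<otimes> d) (b \<otimes> d)" "lt (d \<otimes> a) (d \<otimes> b)"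
  "lt (b \<otimes> c) (b \<otimes> d)" "lt (c \<otimes> b) (d \<otimes> b)" "lt (b \<otimes> d) (c \<otimes> d)" "lt (d \<otimes> b) (d \<otimes> c)"
  "lt (c \<otimes> c) (c \<otimes> d)" "lt (c \<otimes> c) (d \<otimes> c)" "lt (c \<otimes> d) (d \<otimes> d)" "lt (d \<otimes> c) (d \<otimes> d)"
  using less by simp_all

lemma subset_square:
  "A \<subseteq> {a, b, c, d} \<Longrightarrow> A <#> A \<subseteq> {a, b, c, d} <#> {a, b, c, d}"
  by (intro mono_set_mult)

lemma square_eq:
  assumes "A \<subseteq> {a, b, c, d} <#> {a, b, c, d}" "card A = 10"
  shows "{a, b, c, d} <#> {a, b, c, d} = A"
  using assms card_square by (intro card_subset_eq[symmetric] set_mult_finite) simp_all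

text \<open>Otherwise \<open>M = {b, c}\<close> has a square of size 3, and the squares of the two triples contribute
  four further products each, those of the first below \<open>bc\<close> and those of the second above it.\<close>

lemma middle_noncommuting: "b \<otimes> c \<noteq> c \<otimes> b"
proof
  assume bc: "b \<otimes> c = c \<otimes> b"
  define M U V where "M = {b \<otimes> b, b \<otimes> c, c \<otimes> c}"
    and "U = {a \<otimes> a, a \<otimes> b, b \<otimes> a, a \<otimes> c, c \<otimes> a}" and "V = {b \<otimes> d, d \<otimes> b, c \<otimes> d, d \<otimes> c, d \<otimes> d}"
  have "{a, b, c} <#> {a, b, c} = M \<union> U" "{b, c, d} <#> {b, c, d} = M \<union> V"
    unfolding set_mult_def M_def U_def V_def using bc by auto
  then have MUV: "card (M \<union> U) = 7" "card (M \<union> V) = 7" "M \<union> U \<union> V \<subseteq> {a, b, c, d} <#> {a, b, c, d}"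
    using initial(1) final(1) subset_square[of "{a, b, c}"] subset_square[of "{b, c, d}"] by auto
  have fin: "finite M" "finite U" "finite V"
    by (auto simp: M_def U_def V_def)
  have lt: "lt u (b \<otimes> c)" if "u \<in> U" for u
    using that products_less bc unfolding U_def by (elim insertE emptyE; order)
  have gt: "lt (b \<otimes> c) v" if "v \<in> V" for v
    using that products_less bc unfolding V_def by (elim insertE emptyE; order)
  have "distinct [b \<otimes> b, b \<otimes> c, c \<otimes> c]"
    using products_less by (simp, intro conjI; order)
  then have "card M = 3"
    unfolding M_def by simp
  then have "card (U - M) = 4" "card (V - M) = 4"
    using MUV(1,2) fin card_Un_disjoint[of M "U - M"] card_Un_disjoint[of M "V - M"] by simp_all
  moreover have "(U - M) \<inter> (V - M) = {}"
  proof (rule ccontr)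
    assume "\<not> ?thesis"
    then obtain u where "u \<in> U" "u \<in> V"
      by blast
    then show False
      using lt[OF \<open>u \<in> U\<close>] gt[OF \<open>u \<in> V\<close>] by order
  qed
  ultimately have "card (M \<union> ((U - M) \<union> (V - M))) = 11"
    using \<open>card M = 3\<close> fin by (subst card_Un_disjoint, simp, simp, blast, subst card_Un_disjoint) auto
  moreover have "card (M \<union> ((U - M) \<union> (V - M))) \<le> 10"
    unfolding card_square[symmetric] by (rule card_mono) (use MUV(3) in \<open>auto intro: set_mult_finite\<close>)
  ultimately show False
    by simp
qed

lemma commuting_pair_final:
  assumes "c \<otimes> d = d \<otimes> c" "b \<otimes> d \<noteq> d \<otimes> b"
  shows "b \<otimes> d = c \<otimes> b \<or> d \<otimes> b = b \<otimes> c"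
proof -
  interpret C: ordered_group G "r\<inverse>"
    by (rule ordered_group_converse)
  have "d \<otimes> b = b \<otimes> c \<or> b \<otimes> d = c \<otimes> b"
  proof (rule C.three_chain_commuting_pair)
    show "C.lt d c" "C.lt c b"
      using less by (simp_all add: lt_converse)
    have "{d, c, b} = {b, c, d}" by auto
    then show "card ({d, c, b} <#> {d, c, b}) = 7"
      using final(1) by simp
  qed (use assms middle_noncommuting in auto)
  then show ?thesis
    by blast
qed

text \<open>As \<open>a\<close>, \<open>b\<close>, \<open>c\<close> generate, \<open>a\<close> is
  central. The equation found for \<open>ad\<close> can be divided by \<open>a\<close>, so that
  \<open>d\<close> becomes a word in \<open>b\<close>, \<open>c\<close> and one quotient
  \<open>w\<close>; a coincidence in the triple \<open>b\<close>, \<open>c\<close>, \<open>d\<close>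
  is then the squaring relation for \<open>w\<close>, and \<open>a\<close> is the direct factor of
  family (ii).\<close>

lemma central_first:
  assumes ab: "a \<otimes> b = b \<otimes> a" and ac: "a \<otimes> c = c \<otimes> a"
  shows "young_relations"
proof -
  have bc: "b \<otimes> c \<noteq> c \<otimes> b"
    by (rule middle_noncommuting)
  have central: "y \<otimes> a = a \<otimes> y" if "y \<in> carrier G" for y
    by (rule commuting_generate[OF initial(2)]) (use that ab ac in auto)
  have left: "y \<otimes> (a \<otimes> z) = a \<otimes> (y \<otimes> z)" if "y \<in> carrier G" "z \<in> carrier G" for y z
    using that central by (metis carr(1) m_assoc)
  have comm: "y \<otimes> d = d \<otimes> y" if "y \<in> carrier G" "y \<otimes> (a \<otimes> d) = a \<otimes> d \<otimes> y" for y
    using that left[of y d] by (simp add: m_assoc)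
  \<comment> \<open>The products \<open>aa\<close>, \<open>ab\<close>, \<open>ac\<close> are not
    products of \<open>b\<close>, \<open>c\<close>, \<open>d\<close>. With the seven of that triple
    they make ten, and \<open>ad\<close> exceeds all three.\<close>
  have "a \<otimes> d \<in> {b, c, d} <#> {b, c, d}"
  proof -
    have ne: "a \<otimes> c \<noteq> b \<otimes> b"
    proof
      assume "a \<otimes> c = b \<otimes> b"
      then have "b \<otimes> (a \<otimes> c) = a \<otimes> c \<otimes> b"
        by (simp add: m_assoc)
      then show False
        using bc by (simp add: left m_assoc)
    qed
    have small: "lt s t" if "s \<in> {a \<otimes> a, a \<otimes> b}" "t \<in> {b, c, d} <#> {b, c, d}" for s t
      using that products_less unfolding set_mult_iff by (elim insertE emptyE bexE; simp only:; order)
    have nac: "t \<noteq> a \<otimes> c" if "t \<in> {b, c, d} <#> {b, c, d}" for t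
      using that products_less ne ac unfolding set_mult_iff by (elim insertE emptyE bexE; simp only:; order)
    have "{a \<otimes> a, a \<otimes> b, a \<otimes> c} \<inter> ({b, c, d} <#> {b, c, d}) = {}"
      using small nac by (fastforce dest: ord.less_imp_neq)
    moreover have "distinct [a \<otimes> a, a \<otimes> b, a \<otimes> c]"
      using products_less by (simp, intro conjI; order)
    then have "card {a \<otimes> a, a \<otimes> b, a \<otimes> c} = 3"
      by simp
    ultimately have "card ({a \<otimes> a, a \<otimes> b, a \<otimes> c} \<union> ({b, c, d} <#> {b, c, d})) = 10"
      using final(1) by (subst card_Un_disjoint) (auto intro: set_mult_finite)
    then have "{a, b, c, d} <#> {a, b, c, d} = {a \<otimes> a, a \<otimes> b, a \<otimes> c} \<union> ({b, c, d} <#> {b, c, d})"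
      using subset_square[of "{b, c, d}"] by (intro square_eq) (auto simp: set_multI)
    moreover have "a \<otimes> d \<in> {a, b, c, d} <#> {a, b, c, d}"
      by (simp add: set_multI)
    moreover have "a \<otimes> d \<noteq> a \<otimes> a" "a \<otimes> d \<noteq> a \<otimes> b" "a \<otimes> d \<noteq> a \<otimes> c"
      using products_less by order+
    ultimately show ?thesis
      by blast
  qed
  moreover have "a \<otimes> d \<noteq> b \<otimes> d" "a \<otimes> d \<noteq> d \<otimes> b" "a \<otimes> d \<noteq> c \<otimes> d" "a \<otimes> d \<noteq> d \<otimes> c"
    "a \<otimes> d \<noteq> d \<otimes> d"
    using products_less central[OF carr(4)] by order+
  ultimately have ad: "a \<otimes> d = b \<otimes> b \<or> a \<otimes> d = b \<otimes> c \<or> a \<otimes> d = c \<otimes> b \<or> a \<otimes> d = c \<otimes> c"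
    unfolding three_square_iff by argo
  have conclude: "young_relations"
    if "w \<in> carrier G" "x \<in> carrier G" "w \<otimes> x = x \<otimes> w \<otimes> w \<or> w \<otimes> w \<otimes> x = x \<otimes> w" "w \<noteq> \<one>"
      "{b, c} \<subseteq> generate G {a, x, w}" for w x
  proof -
    have "{a, b, c} \<subseteq> generate G {a, x, w}"
      using that(5) by (auto intro: generate.incl)
    then have "carrier G = generate G {a, x, w}"
      by (rule generate_eq_carrierI[OF initial(2)]) (use that(1,2) in auto)
    then show ?thesis
      using that(1-4) central[OF that(1), symmetric] central[OF that(2), symmetric] carr(1)
      unfolding young_relations_def by blast
  qed
  have comm': "y \<otimes> (a \<otimes> d) = a \<otimes> d \<otimes> y" if "y \<in> carrier G" "y \<otimes> d = d \<otimes> y" for y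
    using that by (simp add: left m_assoc)
  have bb: "b \<otimes> d = d \<otimes> b" if "a \<otimes> d = b \<otimes> b"
    by (rule comm) (simp_all add: that m_assoc)
  have cc: "c \<otimes> d = d \<otimes> c" if "a \<otimes> d = c \<otimes> c"
    by (rule comm) (simp_all add: that m_assoc)
  have not_comm: "b \<otimes> (b \<otimes> c) \<noteq> b \<otimes> c \<otimes> b" "b \<otimes> (c \<otimes> b) \<noteq> c \<otimes> b \<otimes> b"
    "c \<otimes> (b \<otimes> c) \<noteq> b \<otimes> c \<otimes> c" "c \<otimes> (c \<otimes> b) \<noteq> c \<otimes> b \<otimes> c"
    "b \<otimes> (c \<otimes> c) \<noteq> c \<otimes> c \<otimes> b" "c \<otimes> (b \<otimes> b) \<noteq> b \<otimes> b \<otimes> c"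
  proof -
    show "b \<otimes> (b \<otimes> c) \<noteq> b \<otimes> c \<otimes> b" "c \<otimes> (c \<otimes> b) \<noteq> c \<otimes> b \<otimes> c"
      using bc by (simp_all add: m_assoc)
    show "b \<otimes> (c \<otimes> b) \<noteq> c \<otimes> b \<otimes> b" "c \<otimes> (b \<otimes> c) \<noteq> b \<otimes> c \<otimes> c"
      using bc by (simp_all flip: m_assoc)
    show "b \<otimes> (c \<otimes> c) \<noteq> c \<otimes> c \<otimes> b" "c \<otimes> (b \<otimes> b) \<noteq> b \<otimes> b \<otimes> c"
      using bc square_commute_imp_commute[OF carr(2,3)] square_commute_imp_commute[OF carr(3,2)] by metis+
  qed
  show ?thesis
  proof (cases "c \<otimes> d = d \<otimes> c")
    case True
    have bd: "b \<otimes> d \<noteq> d \<otimes> b"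
    proof
      assume "b \<otimes> d = d \<otimes> b"
      then show False
        using ad comm'[of b] comm'[of c] True not_comm by (elim disjE) simp_all
    qed
    have disj: "b \<otimes> d = c \<otimes> b \<or> d \<otimes> b = b \<otimes> c"
      by (rule commuting_pair_final[OF True bd])
    have "a \<otimes> d = c \<otimes> c"
      using ad bb bd comm'[of c] True not_comm by (elim disjE) simp_all
    \<comment> \<open>Centrality turns \<open>ad = cc\<close> into \<open>d = wc\<close>, and the
      coincidence between \<open>b\<close>, \<open>c\<close>, \<open>d\<close> then relates
      \<open>w\<close> to \<open>b\<close>.\<close>
    define w where "w = inv a \<otimes> c"
    have w: "w \<in> carrier G" and ceq: "c = a \<otimes> w"
      by (simp_all add: w_def)
    have w1: "w \<noteq> \<one>"
      using less'(1) ceq by auto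
    have "a \<otimes> d = a \<otimes> (w \<otimes> c)"
      unfolding \<open>a \<otimes> d = c \<otimes> c\<close> using w by (subst ceq) (simp add: m_assoc)
    then have deq: "d = w \<otimes> c"
      using w by simp
    have "w \<otimes> b = b \<otimes> w \<otimes> w \<or> w \<otimes> w \<otimes> b = b \<otimes> w"
      using disj
    proof (elim disjE)
      assume "d \<otimes> b = b \<otimes> c"
      then have "a \<otimes> (w \<otimes> (w \<otimes> b)) = a \<otimes> (b \<otimes> w)"
        unfolding deq ceq using w by (simp add: m_assoc left)
      then show ?thesis
        using w by (simp add: m_assoc)
    next
      assume "b \<otimes> d = c \<otimes> b"
      then have "a \<otimes> (b \<otimes> (w \<otimes> w)) = a \<otimes> (w \<otimes> b)"
        unfolding deq ceq using w by (simp add: m_assoc left)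
      then show ?thesis
        using w by (simp add: m_assoc)
    qed
    moreover have "{b, c} \<subseteq> generate G {a, b, w}"
      unfolding ceq by (auto intro: generate.eng generate.incl)
    ultimately show ?thesis
      using w w1 by (intro conclude[of w b]) simp_all
  next
    case False
    note bd = three_chain_square(2,3)[OF carr(2,3,4) less(2,3) bc False final(1)]
    have "b \<noteq> c"
      using less(2) by auto
    have "a \<otimes> d \<noteq> b \<otimes> b"
    proof
      assume "a \<otimes> d = b \<otimes> b"
      then have "b \<otimes> d = c \<otimes> c"
        using bb bd bc False \<open>b \<noteq> c\<close> by (elim disjE) simp_all
      moreover have "b \<otimes> (d \<otimes> b) = b \<otimes> d \<otimes> b"
        by (simp add: m_assoc)
      then have "b \<otimes> (b \<otimes> d) = b \<otimes> d \<otimes> b"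
        by (simp only: bb[OF \<open>a \<otimes> d = b \<otimes> b\<close>, symmetric])
      ultimately show False
        using not_comm by simp
    qed
    then have "a \<otimes> d = b \<otimes> c \<or> a \<otimes> d = c \<otimes> b"
      using ad cc False by blast
    \<comment> \<open>Here \<open>ad\<close> is \<open>bc\<close> or \<open>cb\<close>, so
      \<open>d\<close> is \<open>wc\<close> or \<open>cw\<close>, and the relation obtained is one
      between \<open>w\<close> and \<open>c\<close>.\<close>
    define w where "w = inv a \<otimes> b"
    have w: "w \<in> carrier G" and beq: "b = a \<otimes> w"
      by (simp_all add: w_def)
    have w1: "w \<noteq> \<one>"
      using less(1) beq by auto
    have bw: "b \<otimes> w = w \<otimes> b"
      unfolding beq using w by (simp add: left m_assoc)
    have wbc: "w \<otimes> b \<noteq> c"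
    proof
      assume "w \<otimes> b = c"
      then have "c \<otimes> b = b \<otimes> c"
        using bw w by (metis carr(2) m_assoc)
      then show False using bc by simp
    qed
    have "w \<otimes> c = c \<otimes> w \<otimes> w \<or> w \<otimes> w \<otimes> c = c \<otimes> w"
      using \<open>a \<otimes> d = b \<otimes> c \<or> a \<otimes> d = c \<otimes> b\<close>
    proof
      assume "a \<otimes> d = b \<otimes> c"
      then have "a \<otimes> d = a \<otimes> (w \<otimes> c)"
        using w by (subst (asm) beq) (simp add: m_assoc)
      then have deq: "d = w \<otimes> c"
        using w by simp
      from bd(1) show ?thesis
      proof (elim disjE)
        assume "b \<otimes> d = c \<otimes> b"
        then have "a \<otimes> (w \<otimes> (w \<otimes> c)) = a \<otimes> (c \<otimes> w)"
          unfolding deq beq using w by (simp add: m_assoc left)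
        then show ?thesis
          using w by (simp add: m_assoc)
      next
        assume "b \<otimes> d = c \<otimes> c"
        then have "w \<otimes> b \<otimes> c = c \<otimes> c"
          unfolding deq bw[symmetric] using w by (simp add: m_assoc)
        then show ?thesis
          using w wbc by simp
      next
        assume "b \<otimes> d = d \<otimes> c"
        then have "b \<otimes> w \<otimes> c = w \<otimes> c \<otimes> c"
          unfolding deq using w by (simp add: m_assoc)
        then have "w \<otimes> b = w \<otimes> c"
          unfolding bw using w by simp
        then show ?thesis
          using w \<open>b \<noteq> c\<close> by simp
      qed
    next
      assume "a \<otimes> d = c \<otimes> b"
      then have "a \<otimes> d = a \<otimes> (c \<otimes> w)"
        using w by (subst (asm) beq) (simp add: m_assoc left)
      then have deq: "d = c \<otimes> w"
        using w by simp
      from bd(2) show ?thesis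
      proof (elim disjE)
        assume "d \<otimes> b = b \<otimes> c"
        then have "a \<otimes> (c \<otimes> (w \<otimes> w)) = a \<otimes> (w \<otimes> c)"
          unfolding deq beq using w by (simp add: m_assoc left)
        then show ?thesis
          using w by (simp add: m_assoc)
      next
        assume "d \<otimes> b = c \<otimes> c"
        then have "c \<otimes> (w \<otimes> b) = c \<otimes> c"
          unfolding deq using w by (simp add: m_assoc)
        then show ?thesis
          using w wbc by simp
      next
        assume "d \<otimes> b = c \<otimes> d"
        then have "c \<otimes> (w \<otimes> b) = c \<otimes> (c \<otimes> w)"
          unfolding deq using w by (simp add: m_assoc)
        then have "b \<otimes> w = c \<otimes> w"
          unfolding bw using w by simp
        then show ?thesis
          using w \<open>b \<noteq> c\<close> by simp
      qed
    qed
    moreover have "{b, c} \<subseteq> generate G {a, c, w}"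
      unfolding beq by (auto intro: generate.eng generate.incl)
    ultimately show ?thesis
      using w w1 by (intro conclude[of w c]) simp_all
  qed
qed

text \<open>The three extra products are smaller than \<open>bb\<close>, the least product of
  \<open>b\<close>, \<open>c\<close>, \<open>d\<close>, and \<open>3 + 7 = 10\<close>.\<close>

lemma square_bottom:
  assumes "a \<otimes> b \<noteq> b \<otimes> a"
  shows "{a, b, c, d} <#> {a, b, c, d} = {a \<otimes> a, a \<otimes> b, b \<otimes> a} \<union> ({b, c, d} <#> {b, c, d})"
proof -
  have small: "s \<noteq> t" if "s \<in> {a \<otimes> a, a \<otimes> b, b \<otimes> a}" "t \<in> {b, c, d} <#> {b, c, d}" for s t
    using that products_less unfolding set_mult_iff by (elim insertE emptyE bexE; simp only:; order)
  have "{a \<otimes> a, a \<otimes> b, b \<otimes> a} \<inter> ({b, c, d} <#> {b, c, d}) = {}"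
    using small by blast
  moreover have "distinct [a \<otimes> a, a \<otimes> b, b \<otimes> a]"
    using less(1) assms by (auto simp: lt_def)
  then have "card {a \<otimes> a, a \<otimes> b, b \<otimes> a} = 3"
    by simp
  ultimately have "card ({a \<otimes> a, a \<otimes> b, b \<otimes> a} \<union> ({b, c, d} <#> {b, c, d})) = 10"
    using final(1) by (subst card_Un_disjoint) (auto intro: set_mult_finite)
  then show ?thesis
    using subset_square[of "{b, c, d}"] by (intro square_eq) (auto simp: set_multI)
qed

text \<open>Only \<open>bc\<close> remains for \<open>ad\<close>. Comparison with
  \<open>ac = bb\<close> shows that \<open>b\<close>, \<open>c\<close>, \<open>d\<close> have the
  common ratio \<open>e\<close>, whereupon \<open>bd = cb\<close> says that conjugation by
  \<open>b\<close> squares \<open>e\<close>.\<close>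

lemma bb_cb_young:
  assumes "a \<otimes> b \<noteq> b \<otimes> a" "a \<otimes> c = b \<otimes> b" "b \<otimes> d = c \<otimes> b"
  shows "young_relations"
proof -
  have "a \<otimes> d \<in> {a, b, c, d} <#> {a, b, c, d}"
    by (simp add: set_multI)
  then have "a \<otimes> d \<in> {a \<otimes> a, a \<otimes> b, b \<otimes> a} \<union> ({b, c, d} <#> {b, c, d})"
    unfolding square_bottom[OF assms(1)] .
  moreover have "a \<otimes> d \<noteq> a \<otimes> a" "a \<otimes> d \<noteq> a \<otimes> b" "a \<otimes> d \<noteq> b \<otimes> a" "a \<otimes> d \<noteq> b \<otimes> b" "a \<otimes> d \<noteq> c \<otimes> b"
    "a \<otimes> d \<noteq> c \<otimes> c" "a \<otimes> d \<noteq> b \<otimes> d" "a \<otimes> d \<noteq> d \<otimes> b" "a \<otimes> d \<noteq> c \<otimes> d" "a \<otimes> d \<noteq> d \<otimes> c" "a \<otimes> d \<noteq> d \<otimes> d"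
    using products_less assms(2,3) by order+
  ultimately have ad: "a \<otimes> d = b \<otimes> c"
    unfolding Un_iff insert_iff empty_iff three_square_iff by argo
  define e where "e = inv b \<otimes> c"
  have e: "e \<in> carrier G" and ceq: "c = b \<otimes> e"
    by (simp_all add: e_def)
  have e1: "e \<noteq> \<one>"
    using less(2) ceq by auto
  have aeq: "a = b \<otimes> b \<otimes> inv c"
    using assms(2) by (metis carr(1,2,3) inv_solve_right m_closed)
  have inv_c: "inv c = inv e \<otimes> inv b"
    using e unfolding ceq by (simp add: inv_mult_group)
  have "a \<otimes> c \<otimes> (inv c \<otimes> d) = a \<otimes> d"
    by (simp add: m_assoc)
  then have "b \<otimes> b \<otimes> (inv c \<otimes> d) = b \<otimes> c"
    unfolding assms(2) ad .
  then have "inv c \<otimes> d = e"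
    unfolding e_def by (metis carr e_def ceq e inv_closed inv_mult_cancel l_cancel m_assoc m_closed)
  then have "d = b \<otimes> (e \<otimes> e)"
    using e ceq by (metis carr(2,3,4) m_assoc mult_inv_cancel)
  then have "b \<otimes> (b \<otimes> (e \<otimes> e)) = b \<otimes> (e \<otimes> b)"
    using assms(3) e unfolding ceq by (simp add: m_assoc)
  then have "e \<otimes> b = b \<otimes> e \<otimes> e"
    using e by (simp add: m_assoc)
  moreover have "{a, b, c} \<subseteq> generate G {e, b}"
    unfolding aeq inv_c unfolding ceq
    by (auto intro!: generate.eng intro: generate.incl generate.inv)
  then have "carrier G = generate G {e, b}"
    by (rule generate_eq_carrierI[OF initial(2)]) (use e in auto)
  ultimately show ?thesis
    using e e1 carr(2) unfolding young_relations_def by blast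
qed

text \<open>The count forces \<open>da = cb\<close> and \<open>ad = db\<close>. Then the ratio
  \<open>w\<close> of \<open>c\<close> and \<open>d\<close> is the commutator of \<open>a\<close>
  and \<open>d\<close> and commutes with both, giving family (i).\<close>

lemma ac_cb_db_bc_young:
  assumes ab: "a \<otimes> b = b \<otimes> a" and cd: "c \<otimes> d = d \<otimes> c"
    and nc: "a \<otimes> c \<noteq> c \<otimes> a" "b \<otimes> d \<noteq> d \<otimes> b" and eq: "a \<otimes> c = c \<otimes> b" "d \<otimes> b = b \<otimes> c"
  shows "young_relations"
proof -
  \<comment> \<open>Since \<open>a\<close> commutes with \<open>b\<close>, so does the quotient of
    \<open>bb\<close> by \<open>a\<close>. This keeps \<open>ca\<close>, \<open>da\<close> and
    \<open>ad\<close> away from \<open>bb\<close>.\<close>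
  have comm_b: "t \<otimes> b = b \<otimes> t" if "t \<in> carrier G" "a \<otimes> t = b \<otimes> b \<or> t \<otimes> a = b \<otimes> b" for t
    using that(2)
  proof
    assume t: "a \<otimes> t = b \<otimes> b"
    have "a \<otimes> (t \<otimes> b) = b \<otimes> (a \<otimes> t)"
      using that(1) by (simp add: t m_assoc flip: m_assoc[of a t b])
    also have "\<dots> = a \<otimes> (b \<otimes> t)"
      using that(1) ab by (metis carr(1,2) m_assoc)
    finally show ?thesis
      using that(1) by simp
  next
    assume t: "t \<otimes> a = b \<otimes> b"
    have "b \<otimes> t \<otimes> a = t \<otimes> a \<otimes> b"
      using that(1) by (simp add: t m_assoc)
    also have "\<dots> = t \<otimes> b \<otimes> a"
      using that(1) ab by (metis carr(1,2) m_assoc)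
    finally show ?thesis
      using that(1) by simp
  qed
  have ca: "c \<otimes> a \<noteq> b \<otimes> b"
    using comm_b[of c] middle_noncommuting by auto
  have disj: "s \<noteq> t" if "s \<in> {a \<otimes> a, a \<otimes> b, c \<otimes> a}" "t \<in> {b, c, d} <#> {b, c, d}" for s t
    using that products_less eq ca unfolding set_mult_iff by (elim insertE emptyE bexE; simp only:; order)
  have "{a \<otimes> a, a \<otimes> b, c \<otimes> a} \<inter> ({b, c, d} <#> {b, c, d}) = {}"
    using disj by blast
  moreover have "distinct [a \<otimes> a, a \<otimes> b, c \<otimes> a]"
    using products_less ab by (simp, intro conjI; order)
  then have "card {a \<otimes> a, a \<otimes> b, c \<otimes> a} = 3"
    by simp
  ultimately have "card ({a \<otimes> a, a \<otimes> b, c \<otimes> a} \<union> ({b, c, d} <#> {b, c, d})) = 10"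
    using final(1) by (subst card_Un_disjoint) (auto intro: set_mult_finite)
  then have S: "{a, b, c, d} <#> {a, b, c, d} = {a \<otimes> a, a \<otimes> b, c \<otimes> a} \<union> ({b, c, d} <#> {b, c, d})"
    using subset_square[of "{b, c, d}"] by (intro square_eq) (auto simp: set_multI)
  have "d \<otimes> a \<in> {a, b, c, d} <#> {a, b, c, d}" "a \<otimes> d \<in> {a, b, c, d} <#> {a, b, c, d}"
    by (simp_all add: set_multI)
  note mem = this[unfolded S]
  have db: "d \<otimes> a \<noteq> a \<otimes> b"
    unfolding ab using less'(3) by auto
  have "d \<otimes> a \<noteq> b \<otimes> b"
    using comm_b[of d] nc(2) by auto
  moreover have "d \<otimes> a \<noteq> a \<otimes> a" "d \<otimes> a \<noteq> c \<otimes> a" "d \<otimes> a \<noteq> b \<otimes> c" "d \<otimes> a \<noteq> c \<otimes> c" "d \<otimes> a \<noteq> b \<otimes> d"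
    "d \<otimes> a \<noteq> d \<otimes> b" "d \<otimes> a \<noteq> c \<otimes> d" "d \<otimes> a \<noteq> d \<otimes> c" "d \<otimes> a \<noteq> d \<otimes> d"
    using products_less eq ab by order+
  ultimately have da: "d \<otimes> a = c \<otimes> b"
    using mem(1) db unfolding Un_iff insert_iff empty_iff three_square_iff by argo
  have "a \<otimes> d \<noteq> c \<otimes> c"
  proof
    assume adcc: "a \<otimes> d = c \<otimes> c"
    have "a \<otimes> c \<otimes> d = a \<otimes> d \<otimes> c"
      using cd by (simp add: m_assoc)
    also have "\<dots> = c \<otimes> (a \<otimes> d)"
      by (simp add: adcc m_assoc)
    finally have "a \<otimes> c \<otimes> d = c \<otimes> a \<otimes> d"
      by (simp add: m_assoc)
    then show False
      using nc(1) by simp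
  qed
  moreover have "a \<otimes> d \<noteq> b \<otimes> b"
    using comm_b[of d] nc(2) by auto
  moreover have "a \<otimes> d \<noteq> a \<otimes> a" "a \<otimes> d \<noteq> a \<otimes> b" "a \<otimes> d \<noteq> c \<otimes> a" "a \<otimes> d \<noteq> c \<otimes> b" "a \<otimes> d \<noteq> b \<otimes> d"
    "a \<otimes> d \<noteq> c \<otimes> d" "a \<otimes> d \<noteq> d \<otimes> c" "a \<otimes> d \<noteq> d \<otimes> d"
    using products_less eq da cd by order+
  ultimately have ad: "a \<otimes> d = d \<otimes> b"
    using mem(2) eq(2) unfolding Un_iff insert_iff empty_iff three_square_iff by argo
  define w where "w = inv c \<otimes> d"
  have w: "w \<in> carrier G" and deq: "c \<otimes> w = d"
    by (simp_all add: w_def)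
  have "c \<otimes> (d \<otimes> w) = c \<otimes> (w \<otimes> d)"
  proof -
    have "c \<otimes> (d \<otimes> w) = d \<otimes> (c \<otimes> w)"
      using cd w by (metis carr(3,4) m_assoc)
    also have "\<dots> = c \<otimes> w \<otimes> d"
      unfolding deq ..
    finally show ?thesis
      using w by (simp add: m_assoc)
  qed
  then have dw: "d \<otimes> w = w \<otimes> d"
    using w by simp
  \<comment> \<open>Here \<open>da = cb = ac\<close>, so appending \<open>w\<close> turns the last
    factor \<open>c\<close> into \<open>d\<close>.\<close>
  have "d \<otimes> a \<otimes> w = a \<otimes> (c \<otimes> w)"
    unfolding da eq(1)[symmetric] using w by (simp add: m_assoc)
  then have adw: "a \<otimes> d = d \<otimes> a \<otimes> w"
    unfolding deq ..
  then have "d \<otimes> b = d \<otimes> (a \<otimes> w)"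
    unfolding ad using w by (simp add: m_assoc)
  then have beq: "b = a \<otimes> w"
    using w by simp
  have "a \<otimes> (a \<otimes> w) = a \<otimes> (w \<otimes> a)"
    using ab w unfolding beq by (simp add: m_assoc)
  then have aw: "a \<otimes> w = w \<otimes> a"
    using w by simp
  have g: "a \<in> generate G {a, d}" "d \<in> generate G {a, d}"
    by (auto intro: generate.incl)
  have "inv (d \<otimes> a) \<otimes> (a \<otimes> d) = w"
    unfolding adw using w by simp
  then have gw: "w \<in> generate G {a, d}"
    using g generate_inv[of "{a, d}" "d \<otimes> a"] by (metis carr(1,4) empty_subsetI generate.eng insert_subset)
  have "c = d \<otimes> inv w"
    using deq w by (metis carr(3,4) inv_solve_right)
  then have "c \<in> generate G {a, d}"
    using g gw generate_inv[of "{a, d}" w] by (metis carr(1,4) empty_subsetI generate.eng insert_subset)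
  moreover have "b \<in> generate G {a, d}"
    unfolding beq using g gw by (intro generate.eng)
  ultimately have "{a, b, c} \<subseteq> generate G {a, d}"
    using g by simp
  then have "carrier G = generate G {a, d}"
    by (rule generate_eq_carrierI[OF initial(2)]) simp
  then show ?thesis
    using w adw aw dw carr(1,4) unfolding young_relations_def by blast
qed

end

text \<open>The conjugates \<open>e\<^sub>n\<close> of \<open>e = e\<^sub>0\<close> by \<open>a\<^sup>n\<close> satisfy \<open>e\<^sub>n\<^sub>+\<^sub>2 = e\<^sub>n\<^sub>+\<^sub>1e\<^sub>n\<close>, and \<open>f = e\<^sub>1\<close>. The remaining
  relation between \<open>d\<close> and the other elements forces \<open>e\<close> and \<open>f\<close> to commute.\<close>

locale fibonacci_chain = four_chain +
  fixes e f
  assumes ef [simp]: "e \<in> carrier G" "f \<in> carrier G"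
    and beq: "b = a \<otimes> e" and ceq: "c = a \<otimes> f"
    and ac_ba: "a \<otimes> c = b \<otimes> a" and ca_bb: "c \<otimes> a = b \<otimes> b"
begin

lemma ea: "e \<otimes> a = a \<otimes> f"
proof -
  have "b \<otimes> a = a \<otimes> c"
    by (rule ac_ba[symmetric])
  then have "a \<otimes> (e \<otimes> a) = a \<otimes> (a \<otimes> f)"
    unfolding beq ceq by (simp add: m_assoc)
  then show ?thesis
    by simp
qed

lemma ea': "z \<in> carrier G \<Longrightarrow> e \<otimes> (a \<otimes> z) = a \<otimes> (f \<otimes> z)"
  by (metis carr(1) ea ef m_assoc)

lemma fa: "f \<otimes> a = a \<otimes> (f \<otimes> e)"
proof -
  have "a \<otimes> (f \<otimes> a) = a \<otimes> (a \<otimes> (f \<otimes> e))"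
    using ca_bb unfolding beq ceq by (simp add: m_assoc ea')
  then show ?thesis
    by simp
qed

lemma fa': "z \<in> carrier G \<Longrightarrow> f \<otimes> (a \<otimes> z) = a \<otimes> (f \<otimes> (e \<otimes> z))"
  by (metis carr(1) fa ef m_assoc m_closed)

text \<open>As rewrite rules these move each \<open>a\<close> to the left past \<open>e\<close> and
  \<open>f\<close>. Both sides of a relation become a power of \<open>a\<close> times a word in
  \<open>e\<close> and \<open>f\<close>, and the powers cancel.\<close>

lemmas rules = ea ea' fa fa'

lemma young: "e \<otimes> f = f \<otimes> e \<Longrightarrow> young_relations"
proof -
  assume comm: "e \<otimes> f = f \<otimes> e"
  have "e \<noteq> \<one>"
    using less(1) beq by auto
  moreover have "f = inv a \<otimes> (e \<otimes> a)"
    by (simp add: ea)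
  then have "f \<in> generate G {e, a}"
    by (metis generate.eng generate.incl generate.inv insertI1 insertI2)
  then have "{a, b, c} \<subseteq> generate G {e, a}"
    unfolding beq ceq by (auto intro: generate.eng generate.incl)
  ultimately show ?thesis
    using fibonacci_young[OF carr(1) ef ea fa comm _ initial(2)] by simp
qed

text \<open>The first equation gives \<open>d = aee\<close>. The second becomes
  \<open>eee = ff\<close>, so that \<open>e\<close> commutes with \<open>ff\<close>, or directly
  \<open>fe = ef\<close>.\<close>

lemma cb_commuting:
  assumes "b \<otimes> d = c \<otimes> b" "c \<otimes> d = d \<otimes> c \<or> d \<otimes> b = c \<otimes> c"
  shows "young_relations"
proof -
  have "b \<otimes> d = b \<otimes> (a \<otimes> (e \<otimes> e))"
    unfolding assms(1) unfolding beq ceq by (simp add: m_assoc rules)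
  then have deq: "d = a \<otimes> (e \<otimes> e)"
    by simp
  have "e \<otimes> f = f \<otimes> e"
    using assms(2)
  proof
    assume "c \<otimes> d = d \<otimes> c"
    then have "a \<otimes> (a \<otimes> (f \<otimes> (e \<otimes> (e \<otimes> e)))) = a \<otimes> (a \<otimes> (f \<otimes> (f \<otimes> f)))"
      unfolding deq ceq by (simp add: m_assoc rules)
    then have eee: "e \<otimes> (e \<otimes> e) = f \<otimes> f"
      by simp
    have "e \<otimes> (e \<otimes> e) \<otimes> e = e \<otimes> (e \<otimes> (e \<otimes> e))"
      by (simp add: m_assoc)
    then have "f \<otimes> f \<otimes> e = e \<otimes> (f \<otimes> f)"
      unfolding eee .
    then show ?thesis
      using square_commute_imp_commute[of f e] by simp
  next
    assume "d \<otimes> b = c \<otimes> c"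
    then have "a \<otimes> (a \<otimes> (f \<otimes> (f \<otimes> e))) = a \<otimes> (a \<otimes> (f \<otimes> (e \<otimes> f)))"
      unfolding deq beq ceq by (simp add: m_assoc rules)
    then show ?thesis
      by simp
  qed
  then show ?thesis
    by (rule young)
qed

text \<open>Here \<open>d = aef\<close>, and the second equation says that \<open>ee\<close>
  commutes with \<open>f\<close>.\<close>

lemma cc_cd:
  assumes "b \<otimes> d = c \<otimes> c" "d \<otimes> b = c \<otimes> d"
  shows "young_relations"
proof -
  have "b \<otimes> d = b \<otimes> (a \<otimes> (e \<otimes> f))"
    unfolding assms(1) unfolding beq ceq by (simp add: m_assoc rules)
  then have deq: "d = a \<otimes> (e \<otimes> f)"
    by simp
  have "a \<otimes> (a \<otimes> (f \<otimes> (f \<otimes> (e \<otimes> e)))) = a \<otimes> (a \<otimes> (f \<otimes> (e \<otimes> (e \<otimes> f))))"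
    using assms(2) unfolding deq beq ceq by (simp add: m_assoc rules)
  then have "e \<otimes> e \<otimes> f = f \<otimes> (e \<otimes> e)"
    by (simp add: m_assoc)
  then show ?thesis
    using young square_commute_imp_commute[of e f] by simp
qed

text \<open>Now \<open>d\<close> cannot be read off from one equation. One of them gives the image
  of \<open>g\<close> under conjugation by \<open>a\<close>, the other \<open>g\<close> itself as a
  word in \<open>e\<close> and \<open>f\<close>; consistency of the two is the decisive
  relation.\<close>

lemma dc_cc:
  assumes "b \<otimes> d = d \<otimes> c" "d \<otimes> b = c \<otimes> c"
  shows "young_relations"
proof -
  define g where "g = inv a \<otimes> d"
  have g: "g \<in> carrier G" and deq: "d = a \<otimes> g"
    by (simp_all add: g_def)
  have "a \<otimes> (g \<otimes> (a \<otimes> e)) = a \<otimes> (a \<otimes> (f \<otimes> (e \<otimes> f)))"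
    using assms(2) unfolding deq beq ceq using g by (simp add: m_assoc rules)
  then have "g \<otimes> (a \<otimes> e) \<otimes> inv e = a \<otimes> (f \<otimes> (e \<otimes> f)) \<otimes> inv e"
    using g by simp
  then have ga: "g \<otimes> a = a \<otimes> (f \<otimes> (e \<otimes> (f \<otimes> inv e)))"
    using g by (simp add: m_assoc)
  have ga': "g \<otimes> (a \<otimes> z) = a \<otimes> (f \<otimes> (e \<otimes> (f \<otimes> (inv e \<otimes> z))))" if "z \<in> carrier G" for z
  proof -
    have "g \<otimes> (a \<otimes> z) = g \<otimes> a \<otimes> z"
      using g that by (simp add: m_assoc)
    then show ?thesis
      using that by (simp add: ga m_assoc)
  qed
  have "a \<otimes> (a \<otimes> (f \<otimes> g)) = a \<otimes> (a \<otimes> (f \<otimes> (e \<otimes> (f \<otimes> (inv e \<otimes> f)))))"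
    using assms(1) unfolding deq beq ceq using g by (simp add: m_assoc rules ga')
  then have geq: "g = e \<otimes> (f \<otimes> (inv e \<otimes> f))"
    using g by simp
  have "inv e \<otimes> (a \<otimes> f) = a"
    by (simp flip: rules(1))
  then have "inv e \<otimes> a = a \<otimes> inv f"
    by (metis ef carr(1) inv_closed inv_solve_right m_assoc m_closed)
  then have inv_ea: "inv e \<otimes> (a \<otimes> z) = a \<otimes> (inv f \<otimes> z)" if "z \<in> carrier G" for z
    using that by (metis ef carr(1) inv_closed m_assoc)
  \<comment> \<open>Second computation of the conjugate of \<open>g\<close>, this time from its
    word.\<close>
  have "g \<otimes> a = a \<otimes> (f \<otimes> (f \<otimes> (e \<otimes> e)))"
    unfolding geq by (simp add: m_assoc rules inv_ea)
  then have "a \<otimes> (f \<otimes> (e \<otimes> (f \<otimes> inv e))) = a \<otimes> (f \<otimes> (f \<otimes> (e \<otimes> e)))"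
    unfolding ga .
  then have "e \<otimes> (f \<otimes> inv e) \<otimes> e = f \<otimes> (e \<otimes> e) \<otimes> e"
    by simp
  then have feee: "e \<otimes> f = f \<otimes> (e \<otimes> (e \<otimes> e))"
    by (simp add: m_assoc)
  \<comment> \<open>Conjugating the relation by \<open>a\<close> gives another one between
    \<open>e\<close> and \<open>f\<close>. Together they yield \<open>eeff = 1\<close>, so
    \<open>ff\<close> is the inverse of \<open>ee\<close> and commutes with
    \<open>e\<close>.\<close>
  then have "e \<otimes> f \<otimes> a = f \<otimes> (e \<otimes> (e \<otimes> e)) \<otimes> a"
    by simp
  then have "a \<otimes> (f \<otimes> (f \<otimes> e)) = a \<otimes> (f \<otimes> (e \<otimes> (f \<otimes> (f \<otimes> f))))"
    by (simp add: m_assoc rules)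
  then have "f \<otimes> e = e \<otimes> f \<otimes> (f \<otimes> f)"
    by (simp add: m_assoc)
  also have "\<dots> = f \<otimes> (e \<otimes> (e \<otimes> (e \<otimes> (f \<otimes> f))))"
    unfolding feee by (simp add: m_assoc)
  finally have "e \<otimes> (e \<otimes> (f \<otimes> f)) = \<one>"
    by simp
  then have "e \<otimes> (f \<otimes> f) = inv e"
    using inv_mult_cancel[of e "e \<otimes> (f \<otimes> f)"] by simp
  moreover from this have "f \<otimes> f = inv e \<otimes> inv e"
    using inv_mult_cancel[of e "f \<otimes> f"] by simp
  then have "f \<otimes> f \<otimes> e = inv e"
    by (simp add: m_assoc)
  ultimately have "f \<otimes> f \<otimes> e = e \<otimes> (f \<otimes> f)"
    by simp
  then show ?thesis
    using young square_commute_imp_commute[of f e] by simp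
qed

end

text \<open>Translates the hypotheses of a lemma applied to the inverted chain back to the original
  elements.\<close>

lemma (in group) inv_mult_inv_eq_iff:
  assumes "x \<in> carrier G" "y \<in> carrier G" "u \<in> carrier G" "v \<in> carrier G"
  shows "inv x \<otimes> inv y = inv u \<otimes> inv v \<longleftrightarrow> y \<otimes> x = v \<otimes> u"
proof -
  have "inv x \<otimes> inv y = inv u \<otimes> inv v \<longleftrightarrow> inv (y \<otimes> x) = inv (v \<otimes> u)"
    using assms by (simp add: inv_mult_group)
  also have "\<dots> \<longleftrightarrow> y \<otimes> x = v \<otimes> u"
    using assms by (metis inv_inv m_closed)
  finally show ?thesis .
qed

section \<open>Combination of the relations of the two triples\<close>

context four_chain
begin

lemma fibonacci_chain:
  assumes "a \<otimes> c = b \<otimes> a" "c \<otimes> a = b \<otimes> b"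
  shows "fibonacci_chain G r a b c d (inv a \<otimes> b) (inv a \<otimes> c)"
  by unfold_locales (simp_all add: assms)

text \<open>The two Baumslag-Solitar types are settled at once. The other four are one Fibonacci
  type up to symmetry: inversion exchanges the first two and the last two, and reversal of the
  triple carries the first to the third.\<close>

lemma types:
  assumes "a \<otimes> b \<noteq> b \<otimes> a"
  shows "young_relations \<or>
    a \<otimes> c = b \<otimes> a \<and> c \<otimes> a = b \<otimes> b \<or> a \<otimes> c = b \<otimes> b \<and> c \<otimes> a = a \<otimes> b \<or>
    a \<otimes> c = b \<otimes> b \<and> c \<otimes> a = b \<otimes> c \<or> a \<otimes> c = c \<otimes> b \<and> c \<otimes> a = b \<otimes> b"
proof -
  have "a \<noteq> c"
    using less'(1) by auto
  then show ?thesis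
    using three_chain_types[OF carr(1,2,3) less(1,2) assms middle_noncommuting initial(1)]
      baumslag_solitar_young[OF carr(1,2,3) initial(2)] by argo
qed

lemma types':
  assumes "c \<otimes> d \<noteq> d \<otimes> c"
  shows "young_relations \<or>
    b \<otimes> d = c \<otimes> b \<and> d \<otimes> b = c \<otimes> c \<or> b \<otimes> d = c \<otimes> c \<and> d \<otimes> b = b \<otimes> c \<or>
    b \<otimes> d = c \<otimes> c \<and> d \<otimes> b = c \<otimes> d \<or> b \<otimes> d = d \<otimes> c \<and> d \<otimes> b = c \<otimes> c"
proof -
  have "b \<noteq> d"
    using less'(3) by auto
  then show ?thesis
    using three_chain_types[OF carr(2,3,4) less(2,3) middle_noncommuting assms final(1)]
      baumslag_solitar_young[OF carr(2,3,4) final(2)] by argo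
qed

lemma mixed_cb:
  assumes "a \<otimes> b \<noteq> b \<otimes> a" "c \<otimes> d = d \<otimes> c" "b \<otimes> d = c \<otimes> b"
  shows "young_relations"
  using types[OF assms(1)]
proof (elim disjE conjE)
  assume eq: "a \<otimes> c = b \<otimes> a" "c \<otimes> a = b \<otimes> b"
  interpret fibonacci_chain G r a b c d "inv a \<otimes> b" "inv a \<otimes> c"
    by (rule fibonacci_chain[OF eq])
  show ?thesis
    using cb_commuting assms by blast
next
  \<comment> \<open>This would give \<open>ac = bd\<close>, but \<open>ac < bc < bd\<close>.\<close>
  assume "a \<otimes> c = c \<otimes> b"
  then have False
    using products_less assms(3) by order
  then show ?thesis ..
qed (use bb_cb_young assms in blast)+

lemma mixed:
  assumes "a \<otimes> b \<noteq> b \<otimes> a" "c \<otimes> d = d \<otimes> c" "b \<otimes> d \<noteq> d \<otimes> b"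
  shows "young_relations"
proof (cases "b \<otimes> d = c \<otimes> b")
  case True
  then show ?thesis
    using mixed_cb assms by blast
next
  case False
  then have "d \<otimes> b = b \<otimes> c"
    using commuting_pair_final assms by blast
  interpret M: four_chain G "r\<inverse>" "inv a" "inv b" "inv c" "inv d"
    by (rule four_chain_inv)
  show ?thesis
    by (rule M.mixed_cb) (use assms \<open>d \<otimes> b = b \<otimes> c\<close> in \<open>simp_all add: inv_mult_inv_eq_iff\<close>)
qed

lemma fibonacci_initial:
  assumes cd: "c \<otimes> d \<noteq> d \<otimes> c" and eq: "a \<otimes> c = b \<otimes> a" "c \<otimes> a = b \<otimes> b"
  shows "young_relations"
proof -
  interpret fibonacci_chain G r a b c d "inv a \<otimes> b" "inv a \<otimes> c"
    by (rule fibonacci_chain[OF eq])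
  have ab: "a \<otimes> b \<noteq> b \<otimes> a"
    using eq(1) less(2) carr by (auto simp: lt_def simp flip: eq(1))
  interpret M: four_chain G "r\<inverse>" "inv a" "inv b" "inv c" "inv d"
    by (rule four_chain_inv)
  \<comment> \<open>Read in the inverses, \<open>ca = bb\<close> and \<open>db = bc\<close> are the
    hypotheses of \<open>bb_cb_young\<close>.\<close>
  have "young_relations" if "d \<otimes> b = b \<otimes> c"
    by (rule M.bb_cb_young) (use that eq ab in \<open>simp_all add: inv_mult_inv_eq_iff\<close>)
  then show ?thesis
    using types'[OF cd] cb_commuting cc_cd dc_cc by blast
qed

lemma fibonacci_initial':
  assumes cd: "c \<otimes> d \<noteq> d \<otimes> c" and eq: "a \<otimes> c = b \<otimes> b" "c \<otimes> a = a \<otimes> b"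
  shows "young_relations"
proof -
  interpret M: four_chain G "r\<inverse>" "inv a" "inv b" "inv c" "inv d"
    by (rule four_chain_inv)
  show ?thesis
    by (rule M.fibonacci_initial) (use cd eq in \<open>simp_all add: inv_mult_inv_eq_iff\<close>)
qed

text \<open>After the Fibonacci types of the first triple and their reversals for the second, two
  types remain on each side. Of the four combinations, one is \<open>bb_cb_young\<close>, one its
  image under inversion, and two contradict \<open>ca < db\<close> or
  \<open>ac < bd\<close>.\<close>

lemma noncommuting_chain:
  assumes ab: "a \<otimes> b \<noteq> b \<otimes> a" and cd: "c \<otimes> d \<noteq> d \<otimes> c"
  shows "young_relations"
proof -
  interpret C: four_chain G "r\<inverse>" d c b a
    by (rule four_chain_converse)
  interpret M: four_chain G "r\<inverse>" "inv a" "inv b" "inv c" "inv d"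
    by (rule four_chain_inv)
  have "young_relations" if "b \<otimes> d = c \<otimes> c \<and> d \<otimes> b = c \<otimes> d \<or> b \<otimes> d = d \<otimes> c \<and> d \<otimes> b = c \<otimes> c"
    using that C.fibonacci_initial C.fibonacci_initial' ab by metis
  moreover have "young_relations" if "c \<otimes> a = b \<otimes> b" "d \<otimes> b = b \<otimes> c"
    by (rule M.bb_cb_young) (use that ab in \<open>simp_all add: inv_mult_inv_eq_iff\<close>)
  moreover have "\<not> (c \<otimes> a = b \<otimes> c \<and> d \<otimes> b = b \<otimes> c)" "\<not> (a \<otimes> c = c \<otimes> b \<and> b \<otimes> d = c \<otimes> b)"
    using products_less by (metis ord.less_trans ord.less_irrefl)+
  ultimately show ?thesis
    using types[OF ab] types'[OF cd] fibonacci_initial[OF cd] fibonacci_initial'[OF cd]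
      bb_cb_young[OF ab] by argo
qed

theorem four_chain_young: "young_relations"
proof -
  interpret C: four_chain G "r\<inverse>" d c b a
    by (rule four_chain_converse)
  interpret M: four_chain G "r\<inverse>" "inv a" "inv b" "inv c" "inv d"
    by (rule four_chain_inv)
  consider "a \<otimes> b = b \<otimes> a" "a \<otimes> c = c \<otimes> a" | "c \<otimes> d = d \<otimes> c" "b \<otimes> d = d \<otimes> b"
    | "a \<otimes> b \<noteq> b \<otimes> a" "c \<otimes> d \<noteq> d \<otimes> c"
    | "a \<otimes> b \<noteq> b \<otimes> a" "c \<otimes> d = d \<otimes> c" "b \<otimes> d \<noteq> d \<otimes> b"
    | "a \<otimes> b = b \<otimes> a" "a \<otimes> c \<noteq> c \<otimes> a" "c \<otimes> d \<noteq> d \<otimes> c"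
    | "a \<otimes> b = b \<otimes> a" "a \<otimes> c \<noteq> c \<otimes> a" "c \<otimes> d = d \<otimes> c" "b \<otimes> d \<noteq> d \<otimes> b"
    by blast
  then show ?thesis
  proof cases
    case 1
    then show ?thesis by (rule central_first)
  next
    case 2
    then show ?thesis by (intro C.central_first) (simp_all only:)
  next
    case 3
    then show ?thesis by (rule noncommuting_chain)
  next
    case 4
    then show ?thesis by (rule mixed)
  next
    case 5
    show ?thesis
      by (rule C.mixed) (use 5 in \<open>metis+\<close>)
  next
    case 6
    have "a \<otimes> c = c \<otimes> b \<or> c \<otimes> a = b \<otimes> c"
      using three_chain_commuting_pair[OF carr(1,2,3) less(1,2) 6(1,2) middle_noncommuting initial(1)] .
    moreover have "b \<otimes> d = c \<otimes> b \<or> d \<otimes> b = b \<otimes> c"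
      by (rule commuting_pair_final[OF 6(3,4)])
    \<comment> \<open>These combinations would give \<open>ca = db\<close> or
      \<open>ac = bd\<close>. The two that survive are exchanged by inversion.\<close>
    moreover have "\<not> (c \<otimes> a = b \<otimes> c \<and> d \<otimes> b = b \<otimes> c)" "\<not> (a \<otimes> c = c \<otimes> b \<and> b \<otimes> d = c \<otimes> b)"
      using products_less by (metis ord.less_trans ord.less_irrefl)+
    ultimately consider "a \<otimes> c = c \<otimes> b" "d \<otimes> b = b \<otimes> c" | "c \<otimes> a = b \<otimes> c" "b \<otimes> d = c \<otimes> b"
      by blast
    then show ?thesis
    proof cases
      case 1
      then show ?thesis
        using ac_cb_db_bc_young 6 by blast
    next
      case 2
      show ?thesis
        by (rule M.ac_cb_db_bc_young) (use 2 6 in \<open>simp_all add: inv_mult_inv_eq_iff\<close>)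
    qed
  qed
qed

end

subsection \<open>Reduction to four elements\<close>

context ordered_group
begin

lemma four_elements_young:
  assumes "finite S" "S \<subseteq> carrier G" "card S = 4" "card (S <#> S) + 2 = 3 * card S"
    and "\<not> commuting S" "carrier G = generate G S"
  shows "young_relations"
proof -
  define xs where "xs = ord.sorted_list_of_set S"
  have xs: "set xs = S" "sorted_wrt lt xs" "length xs = 4"
    using assms(1,3) by (simp_all add: xs_def)
  then obtain a b c d where abcd: "xs = [a, b, c, d]"
    by (auto simp: numeral_eq_Suc length_Suc_conv)
  then have S: "S = {a, b, c, d}"
    using xs(1) by auto
  have less: "lt a b" "lt b c" "lt c d"
    using xs(2) by (simp_all add: abcd)
  have carr: "a \<in> carrier G" "b \<in> carrier G" "c \<in> carrier G" "d \<in> carrier G"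
    using assms(2) by (simp_all add: S)
  have S10: "card ({a, b, c, d} <#> {a, b, c, d}) = 10"
    using assms(3,4) by (simp add: S)
  interpret C: ordered_group G "r\<inverse>"
    by (rule ordered_group_converse)
  have rev: "{d, c, b, a} = {a, b, c, d}" "{d, c, b} = {b, c, d}"
    by auto
  consider "commuting {a, b, c}" | "commuting {b, c, d}"
    | "\<not> commuting {a, b, c}" "\<not> commuting {b, c, d}"
    by blast
  then show ?thesis
  proof cases
    case 1
    then show ?thesis
      using four_commuting_initial[OF carr less 1 assms(5)[unfolded S] S10 assms(6)[unfolded S]] by simp
  next
    case 2
    show ?thesis
    proof (rule C.four_commuting_initial[OF carr(4,3,2,1)])
      show "C.lt d c" "C.lt c b" "C.lt b a"
        using less carr by (simp_all add: lt_converse)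
      show "commuting {d, c, b}"
        unfolding rev(2) by (rule 2)
      show "\<not> commuting {d, c, b, a}" "card ({d, c, b, a} <#> {d, c, b, a}) = 10"
        "carrier G = generate G {d, c, b, a}"
        unfolding rev(1) by (fact assms(5)[unfolded S] S10 assms(6)[unfolded S])+
    qed
  next
    case 3
    interpret four_chain G r a b c d
      by unfold_locales (use carr less 3 S10 assms(6) S in simp_all)
    show ?thesis
      by (rule four_chain_young)
  qed
qed

lemma reduction:
  assumes "finite S" "S \<subseteq> carrier G" "card S \<ge> 4" "card (S <#> S) + 2 = 3 * card S"
    and "\<not> commuting S" "carrier G = generate G S"
  obtains T where "T \<subseteq> S" "card S = card T + 1" "\<not> commuting T" "card (T <#> T) + 2 = 3 * card T"
    "carrier G = generate G T"
proof -
  note result = that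
  interpret C: ordered_group G "r\<inverse>"
    by (rule ordered_group_converse)
  have "S \<noteq> {}"
    using assms(3) by auto
  then obtain x where x: "x \<in> S" "\<And>t. t \<in> S \<Longrightarrow> le t x"
    using ex_greatest[OF assms(1)] by metis
  obtain y where y: "y \<in> S" "\<And>t. t \<in> S \<Longrightarrow> le y t"
    using ord.Min_in[OF assms(1) \<open>S \<noteq> {}\<close>] ord.Min_le[OF assms(1)] by metis
  have carr: "t \<in> carrier G" if "t \<in> S" for t
    using that assms(2) by auto
  have *: "thesis" if z: "z \<in> S" and nc: "\<not> commuting (S - {z})"
    and R: "card ((S - {z}) <#> (S - {z})) + 2 = 3 * card (S - {z}) \<and> carrier G = generate G (S - {z})" for z
  proof (rule result[of "S - {z}"])
    show "card S = card (S - {z}) + 1"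
      using z assms(1,3) by (simp add: card_Diff_singleton)
  qed (use nc R in auto)
  have ins: "insert z (S - {z}) = S" if "z \<in> S" for z
    using that by auto
  have size: "finite (S - {z})" "S - {z} \<subseteq> carrier G" "3 \<le> card (S - {z})" if "z \<in> S" for z
    using that assms(1,2,3) by auto
  show thesis
  proof (cases "commuting (S - {x})")
    case False
    have "card ((S - {x}) <#> (S - {x})) + 2 = 3 * card (S - {x}) \<and> carrier G = generate G (S - {x})"
      by (rule remove_max[of _ x]) (use x size[OF x(1)] carr[OF x(1)] False assms(4,6) in
        \<open>simp_all only: ins[OF x(1)], auto simp: lt_def\<close>)
    then show thesis
      using * x(1) False by blast
  next
    case True
    then have nc: "\<not> commuting (S - {y})"
      using noncommuting_end[OF assms(1-5) x y] by blast
    have ylt: "C.lt t y" if "t \<in> S - {y}" for t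
      using that y carr by (auto simp: lt_converse lt_def)
    have "card ((S - {y}) <#> (S - {y})) + 2 = 3 * card (S - {y}) \<and> carrier G = generate G (S - {y})"
      by (rule C.remove_max[OF size(1,2)[OF y(1)] carr[OF y(1)] ylt nc size(3)[OF y(1)]])
        (use assms(4,6) in \<open>simp_all only: ins[OF y(1)]\<close>)
    then show thesis
      using * y(1) nc by blast
  qed
qed

theorem small_doubling_young_relations:
  assumes "finite S" "S \<subseteq> carrier G" "card S \<ge> 4" "card (S <#> S) + 2 = 3 * card S"
    and "\<not> commuting S" "carrier G = generate G S"
  shows "young_relations"
  using assms
proof (induction "card S" arbitrary: S rule: less_induct)
  case less
  show ?case
  proof (cases "card S = 4")
    case True
    then show ?thesis
      using four_elements_young less.prems by blast
  next
    case False
    obtain T where T: "T \<subseteq> S" "card S = card T + 1" "\<not> commuting T"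
      "card (T <#> T) + 2 = 3 * card T" "carrier G = generate G T"
      using reduction[OF less.prems] by metis
    show ?thesis
      by (rule less.hyps[of T]) (use T False less.prems(1-3) finite_subset in auto)
  qed
qed

end

subsection \<open>Young groups\<close>

context group
begin

lemma commuting_imp_comm_group:
  assumes "A \<subseteq> carrier G" "commuting A" "carrier G = generate G A"
  shows "comm_group G"
proof (rule group_comm_groupI)
  fix x y assume xy: "x \<in> carrier G" "y \<in> carrier G"
  have "s \<otimes> x = x \<otimes> s" if "s \<in> A" for s
  proof -
    have "x \<otimes> s = s \<otimes> x"
      by (rule commuting_generate[OF assms(3) _ assms(1) _ xy(1)])
        (use that assms(1,2) in \<open>unfold commuting_def, blast+\<close>)
    then show ?thesis ..
  qed
  then have "y \<otimes> x = x \<otimes> y"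
    by (rule commuting_generate[OF assms(3) xy(1) assms(1) _ xy(2)])
  then show "x \<otimes> y = y \<otimes> x" ..
qed

lemma subgroup_generated_generate:
  assumes "A \<subseteq> carrier G"
  shows "subgroup_generated G (generate G A) = subgroup_generated G A"
proof -
  have "generate G A \<subseteq> carrier G"
    by (rule generate_incl[OF assms])
  moreover have "generate G (generate G A) = generate G A"
    using generate_is_subgroup[OF assms] generate_subgroup_incl[of "generate G A" "generate G A"]
    by (auto intro: generate.incl)
  ultimately show ?thesis
    using assms by (simp add: subgroup_generated_def Int_absorb1)
qed

text \<open>Since \<open>a\<close> is central, so is every common element of the two subgroups;
  triviality is therefore demanded only for elements of the second that commute with its generators.
  Centrality also collects the powers of \<open>a\<close> on the left of any word.\<close>

lemma internal_direct_productI: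
  assumes a: "a \<in> carrier G" and A: "A \<subseteq> carrier G" and gen: "carrier G = generate G (insert a A)"
    and comm: "\<And>t. t \<in> A \<Longrightarrow> t \<otimes> a = a \<otimes> t"
    and triv: "\<And>z. \<lbrakk>z \<in> generate G A; \<And>t. t \<in> A \<Longrightarrow> t \<otimes> z = z \<otimes> t\<rbrakk> \<Longrightarrow> z = \<one>"
  shows "internal_direct_product G {a} A"
proof -
  let ?P = "generate G {a}" and ?Q = "generate G A"
  interpret group_disjoint_sum G ?P ?Q
    using a A generate_is_subgroup by (simp add: group_disjoint_sum_def is_group)
  have central_a: "y \<otimes> a = a \<otimes> y" if "y \<in> carrier G" for y
    by (rule commuting_generate[OF gen a _ _ that]) (use a A comm in auto)
  have central: "x \<otimes> y = y \<otimes> x" if "x \<in> ?P" "y \<in> carrier G" for x y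
    by (rule generate_commute[OF _ that(2) _ that(1)]) (use a central_a[OF that(2)] in auto)
  have "z \<in> ?P <#> ?Q" if "z \<in> generate G (insert a A)" for z
    using that
  proof (induction rule: generate.induct)
    case one
    then show ?case
      unfolding set_mult_iff using generate.one[of G] by (metis one_closed r_one)
  next
    case (incl h)
    have "h \<otimes> \<one> \<in> ?P <#> ?Q" if "h = a"
      using that by (intro set_multI) (auto intro: generate.intros)
    moreover have "\<one> \<otimes> h \<in> ?P <#> ?Q" if "h \<in> A"
      using that by (intro set_multI) (auto intro: generate.intros)
    moreover have "h \<in> carrier G"
      using incl a A by auto
    ultimately show ?case
      using incl by auto
  next
    case (inv h)
    have "inv h \<otimes> \<one> \<in> ?P <#> ?Q" if "h = a"
      using that by (intro set_multI) (auto intro: generate.intros)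
    moreover have "\<one> \<otimes> inv h \<in> ?P <#> ?Q" if "h \<in> A"
      using that by (intro set_multI) (auto intro: generate.intros)
    moreover have "h \<in> carrier G"
      using inv a A by auto
    ultimately show ?case
      using inv by auto
  next
    case (eng h1 h2)
    then obtain p1 q1 p2 q2 where pq: "p1 \<in> ?P" "q1 \<in> ?Q" "h1 = p1 \<otimes> q1" "p2 \<in> ?P" "q2 \<in> ?Q" "h2 = p2 \<otimes> q2"
      unfolding set_mult_iff by blast
    then have c: "p1 \<in> carrier G" "q1 \<in> carrier G" "p2 \<in> carrier G" "q2 \<in> carrier G"
      using AG.subset BG.subset by auto
    have "h1 \<otimes> h2 = p1 \<otimes> (q1 \<otimes> p2) \<otimes> q2"
      using c by (simp add: pq m_assoc)
    also have "\<dots> = (p1 \<otimes> p2) \<otimes> (q1 \<otimes> q2)"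
      unfolding central[OF pq(4) c(2), symmetric] using c by (simp add: m_assoc)
    finally show ?case
      using pq by (simp add: set_multI generate.eng)
  qed
  then have "?P <#> ?Q = carrier G"
    using gen AG.subset BG.subset setmult_subset_G[of ?P ?Q] by blast
  moreover have "?P \<inter> ?Q = {\<one>}"
  proof -
    have "z = \<one>" if "z \<in> ?P" "z \<in> ?Q" for z
      by (rule triv[OF that(2)]) (use central[OF that(1)] A in \<open>metis subsetD\<close>)
    then show ?thesis
      using generate.one[of G] by auto
  qed
  moreover have "\<forall>x\<in>?P. \<forall>y\<in>?Q. x \<otimes> y = y \<otimes> x"
    using central BG.subset by blast
  ultimately show ?thesis
    using iso_group_mul_alt a A by (simp add: internal_direct_product_def subgroup_generated_generate)
qed

end

section \<open>Trivial centre of the Baumslag-Solitar group and the return to the definition\<close>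

context ordered_group
begin

text \<open>An element of \<open>\<langle>b, c\<rangle>\<close> is a power of \<open>b\<close> times an element that a power of \<open>b\<close> conjugates
  into \<open>\<langle>c\<rangle>\<close>.\<close>

lemma baumslag_solitar_center_trivial:
  assumes b: "b \<in> carrier G" and c: "c \<in> carrier G" and rel: "c \<otimes> b = b \<otimes> c \<otimes> c" and c1: "c \<noteq> \<one>"
    and z: "z \<in> generate G {b, c}" and zb: "z \<otimes> b = b \<otimes> z" and zc: "z \<otimes> c = c \<otimes> z"
  shows "z = \<one>"
proof -
  define C where "C = generate G {c}"
  define K where "K m n = inv (b [^] m) \<otimes> n \<otimes> b [^] m" for m :: nat and n
  \<comment> \<open>The union of the ascending chain of conjugates of \<open>C\<close> by powers of
    \<open>b\<close>, corresponding to the dyadic rationals in the usual affine model of the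
    group.\<close>
  define N where "N = {n \<in> carrier G. \<exists>m. K m n \<in> C}"
  have CG: "x \<in> carrier G" if "x \<in> C" for x
    using that c generate_incl[of "{c}"] by (auto simp: C_def)
  have Ccomm: "x \<otimes> y = y \<otimes> x" if "x \<in> C" "y \<in> C" for x y
  proof -
    have "c \<otimes> y = y \<otimes> c"
      by (rule sym, rule generate_commute[of "{c}"]) (use that c in \<open>auto simp: C_def\<close>)
    then show ?thesis
      using generate_commute[of "{c}" y x] that c CG unfolding C_def by simp
  qed
  have Cb: "x \<otimes> b = b \<otimes> (x \<otimes> x)" if "x \<in> C" for x
    using that unfolding C_def
  proof (induction rule: generate.induct)
    case (incl h)
    then show ?case
      using rel b c by (simp add: m_assoc)
  next
    case (inv h)
    have "inv c \<otimes> (c \<otimes> b) \<otimes> (inv c \<otimes> inv c) = inv c \<otimes> (b \<otimes> c \<otimes> c) \<otimes> (inv c \<otimes> inv c)"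
      by (simp add: rel)
    then have "b \<otimes> (inv c \<otimes> inv c) = inv c \<otimes> b"
      using b c by (simp add: m_assoc)
    then show ?case
      using inv by simp
  next
    case (eng h1 h2)
    then have h: "h1 \<in> C" "h2 \<in> C" "h1 \<in> carrier G" "h2 \<in> carrier G"
      using CG unfolding C_def by auto
    have "h1 \<otimes> h2 \<otimes> b = h1 \<otimes> b \<otimes> (h2 \<otimes> h2)"
      using eng.IH(2) h b by (simp add: m_assoc)
    also have "\<dots> = b \<otimes> (h1 \<otimes> (h1 \<otimes> h2) \<otimes> h2)"
      using eng.IH(1) h b by (simp add: m_assoc)
    also have "h1 \<otimes> (h1 \<otimes> h2) \<otimes> h2 = h1 \<otimes> (h2 \<otimes> h1) \<otimes> h2"
      by (simp only: Ccomm[OF h(1,2)])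
    also have "\<dots> = h1 \<otimes> h2 \<otimes> (h1 \<otimes> h2)"
      using h by (simp add: m_assoc)
    finally show ?case .
  qed (use b in simp_all)
  have Cconj: "inv b \<otimes> x \<otimes> b \<in> C" if "x \<in> C" for x
  proof -
    have "inv b \<otimes> x \<otimes> b = x \<otimes> x"
      using Cb[OF that] CG[OF that] b by (simp add: m_assoc)
    then show ?thesis
      using that by (simp add: C_def generate.eng)
  qed
  have K: "K m n \<in> carrier G" "K m (n \<otimes> n') = K m n \<otimes> K m n'"
    "K (Suc m) n = inv b \<otimes> K m n \<otimes> b" "K (Suc m) n = K m (inv b \<otimes> n \<otimes> b)"
    if "n \<in> carrier G" "n' \<in> carrier G" for m n n'
  proof -
    show "K m n \<in> carrier G" "K m (n \<otimes> n') = K m n \<otimes> K m n'"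
      "K (Suc m) n = inv b \<otimes> K m n \<otimes> b"
      using that b by (simp_all add: K_def m_assoc inv_mult_group)
    have "b [^] Suc m = b \<otimes> b [^] m"
      using b by (rule nat_pow_Suc2)
    then show "K (Suc m) n = K m (inv b \<otimes> n \<otimes> b)"
      using that b by (simp add: K_def m_assoc inv_mult_group del: nat_pow_Suc)
  qed
  have mono: "K (m + k) n \<in> C" if "K m n \<in> C" "n \<in> carrier G" for m k n
    using that by (induction k) (simp_all add: K(3) Cconj)
  have N_mult: "n \<otimes> n' \<in> N" if nn: "n \<in> N" "n' \<in> N" for n n'
  proof -
    obtain m m' where m: "K m n \<in> C" "K m' n' \<in> C" "n \<in> carrier G" "n' \<in> carrier G"
      using nn by (auto simp: N_def)
    then have "K (m + m') n \<in> C" "K (m + m') n' \<in> C"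
      using mono[of m n m'] mono[of m' n' m] by (simp_all add: add.commute)
    then have "K (m + m') (n \<otimes> n') \<in> C"
      using m by (simp add: K(2) C_def generate.eng)
    then show ?thesis
      using m by (auto simp: N_def)
  qed
  have N_conj: "inv p \<otimes> n \<otimes> p \<in> N" if "p \<in> generate G {b}" "n \<in> N" for p n
    using that
  proof (induction arbitrary: n rule: generate.induct)
    case one
    then show ?case by (simp add: N_def)
  next
    case (incl h)
    then obtain m where "K m n \<in> C" "n \<in> carrier G"
      by (auto simp: N_def)
    then have "K m (inv b \<otimes> n \<otimes> b) \<in> C"
      using K(3,4)[of n n m] Cconj by metis
    then show ?case
      using incl b \<open>n \<in> carrier G\<close> by (auto simp: N_def)
  next
    case (inv h)
    then obtain m where m: "K m n \<in> C" "n \<in> carrier G"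
      by (auto simp: N_def)
    have "K (Suc m) (b \<otimes> n \<otimes> inv b) = K m n"
      using m(2) b by (simp add: K(4) m_assoc)
    then have "K (Suc m) (b \<otimes> n \<otimes> inv b) \<in> C"
      using m(1) by simp
    then show ?case
      using inv b m(2) by (auto simp: N_def)
  next
    case (eng h1 h2)
    have h: "h1 \<in> carrier G" "h2 \<in> carrier G" "n \<in> carrier G"
      using eng generate_incl[of "{b}"] b by (auto simp: N_def)
    have "inv h2 \<otimes> (inv h1 \<otimes> n \<otimes> h1) \<otimes> h2 \<in> N"
      using eng by blast
    then show ?case
      using h by (simp add: m_assoc inv_mult_group)
  qed
  have N_C: "x \<in> N" if "x \<in> C" for x
    using that CG by (auto simp: N_def K_def intro!: exI[of _ "0::nat"])
  have bG: "p \<in> carrier G" if "p \<in> generate G {b}" for p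
    using that generate_incl[of "{b}"] b by auto
  have NG: "n \<in> carrier G" if "n \<in> N" for n
    using that by (simp add: N_def)
  have one: "\<one> \<in> N" "\<one> \<in> generate G {b}"
    using N_C[of \<one>] by (auto simp: C_def generate.one)
  \<comment> \<open>Normal form: \<open>N\<close> is closed under products and under conjugation by
    powers of \<open>b\<close>, so these powers can be collected on the left.\<close>
  have "\<exists>p\<in>generate G {b}. \<exists>n\<in>N. z = p \<otimes> n"
    using z
  proof (induction rule: generate.induct)
    case (incl h)
    then have "h = b \<otimes> \<one> \<and> b \<in> generate G {b} \<or> h = \<one> \<otimes> c \<and> c \<in> N"
      using b c N_C[of c] by (auto simp: C_def intro: generate.incl)
    then show ?case
      using one by blast
  next
    case (inv h)
    then have "inv h = inv b \<otimes> \<one> \<and> inv b \<in> generate G {b} \<or> inv h = \<one> \<otimes> inv c \<and> inv c \<in> N"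
      using b c N_C[of "inv c"] by (auto simp: C_def intro: generate.inv)
    then show ?case
      using one by blast
  next
    case (eng h1 h2)
    then obtain p n p' n' where pn: "p \<in> generate G {b}" "n \<in> N" "h1 = p \<otimes> n"
      "p' \<in> generate G {b}" "n' \<in> N" "h2 = p' \<otimes> n'"
      by blast
    have "h1 \<otimes> h2 = (p \<otimes> p') \<otimes> ((inv p' \<otimes> n \<otimes> p') \<otimes> n')"
      using pn bG NG by (simp add: m_assoc)
    moreover have "p \<otimes> p' \<in> generate G {b}" "(inv p' \<otimes> n \<otimes> p') \<otimes> n' \<in> N"
      using pn N_conj N_mult by (auto intro: generate.eng)
    ultimately show ?case
      by blast
  qed (use one in \<open>force intro: bexI[of _ \<one>]\<close>)
  then obtain p n where pn: "p \<in> generate G {b}" "n \<in> N" "z = p \<otimes> n"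
    by blast
  have pnG: "p \<in> carrier G" "n \<in> carrier G"
    using pn bG NG by auto
  have pb: "p \<otimes> b = b \<otimes> p"
    by (rule generate_commute[of "{b}"]) (use b pn(1) in auto)
  have "p \<otimes> (n \<otimes> b) = b \<otimes> p \<otimes> n"
    using zb pnG b by (simp add: pn(3) m_assoc)
  also have "\<dots> = p \<otimes> (b \<otimes> n)"
    unfolding pb[symmetric] using pnG b by (simp add: m_assoc)
  finally have nb: "n \<otimes> b = b \<otimes> n"
    using pnG b by simp
  obtain m where m: "K m n \<in> C"
    using pn(2) by (auto simp: N_def)
  have "n \<otimes> b [^] m = b [^] m \<otimes> n"
    using nb pnG b by (induction m) (simp_all add: m_assoc, metis m_assoc nat_pow_closed)
  then have "K m n = n"
    using pnG b by (simp add: K_def conj_eq_iff)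
  \<comment> \<open>Commuting with \<open>b\<close>, the element \<open>n\<close> equals its
    conjugate in \<open>C\<close>, where conjugation by \<open>b\<close> squares; thus
    \<open>n\<close> is its own square.\<close>
  then have "b \<otimes> n = b \<otimes> (n \<otimes> n)"
    using Cb[of n] m nb by simp
  then have n1: "n = \<one>"
    using pnG b by simp
  have "p \<in> {b [^] k |k. k \<in> (UNIV :: int set)}"
    using pn(1) b by (simp add: generate_pow)
  then obtain k :: int where k: "p = b [^] k"
    by auto
  \<comment> \<open>For nonzero \<open>k\<close> a positive power of \<open>b\<close> would commute
    with \<open>c\<close>, hence \<open>b\<close> itself would, and the squaring relation would give
    \<open>c = 1\<close>.\<close>
  have "k = 0"
  proof (rule ccontr)
    assume "k \<noteq> 0"
    have pc: "p \<otimes> c = c \<otimes> p"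
    proof -
      have "z = p"
        using pnG(1) by (simp add: pn(3) n1)
      then show ?thesis
        using zc by (rule subst)
    qed
    have "b [^] nat \<bar>k\<bar> \<otimes> c = c \<otimes> b [^] nat \<bar>k\<bar>"
    proof (cases "k > 0")
      case True
      then have kp: "b [^] nat \<bar>k\<bar> = p"
        unfolding k by (simp flip: int_pow_int)
      show ?thesis
        unfolding kp by (rule pc)
    next
      case False
      then have kp: "b [^] nat \<bar>k\<bar> = inv p"
        unfolding k using b \<open>k \<noteq> 0\<close> by (simp flip: int_pow_int int_pow_neg)
      show ?thesis
        unfolding kp
        by (rule generate_commute[of "{p}"]) (use pc pnG(1) c in \<open>auto intro: generate.inv\<close>)
    qed
    then have "b \<otimes> c = c \<otimes> b"
      by (rule pow_commute_imp_commute[OF b c]) (use \<open>k \<noteq> 0\<close> in simp)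
    then have "b \<otimes> c = b \<otimes> (c \<otimes> c)"
      using rel b c by (simp add: m_assoc)
    then show False
      using b c c1 by simp
  qed
  then show ?thesis
    using pn(3) n1 k by simp
qed

text \<open>Families (i), (iii) and (iv) only need positive words rewritten as conjugates and
  commutators. In family (ii) the direct product comes from the trivial centre of
  \<open><b, c>\<close>.\<close>

theorem young_relations_imp_young:
  assumes "young_relations"
  shows "young G r"
proof -
  have "ordered_group G r" ..
  moreover have "\<exists>a\<in>carrier G. \<exists>b\<in>carrier G. carrier G = generate G {a, b} \<and>
      comm G (comm G a b) a = \<one> \<and> comm G (comm G a b) b = \<one>"
    if "a \<in> carrier G" "b \<in> carrier G" "w \<in> carrier G" "carrier G = generate G {a, b}"
      "a \<otimes> b = b \<otimes> a \<otimes> w" "a \<otimes> w = w \<otimes> a" "b \<otimes> w = w \<otimes> b" for a b w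
  proof -
    have "comm G a b = inv a \<otimes> (inv b \<otimes> (a \<otimes> b))"
      using that(1,2) by (simp add: comm_def m_assoc)
    also have "\<dots> = w"
      unfolding that(5) using that(1-3) by (simp add: m_assoc)
    finally have w: "comm G a b = w" .
    have "comm G w t = \<one>" if t: "t \<in> carrier G" "t \<otimes> w = w \<otimes> t" for t
    proof -
      have "comm G w t = inv w \<otimes> (inv t \<otimes> (w \<otimes> t))"
        using t(1) \<open>w \<in> carrier G\<close> by (simp add: comm_def m_assoc)
      then show ?thesis
        unfolding t(2)[symmetric] using t(1) \<open>w \<in> carrier G\<close> by simp
    qed
    then show ?thesis
      using that w by auto
  qed
  moreover have "internal_direct_product G {a} {b, c} \<and>
      (conj_by G c b = c [^] (2::nat) \<or> conj_by G (c [^] (2::nat)) b = c)"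
    if "a \<in> carrier G" "b \<in> carrier G" "c \<in> carrier G" "carrier G = generate G {a, b, c}"
      "a \<otimes> b = b \<otimes> a" "a \<otimes> c = c \<otimes> a" "c \<otimes> b = b \<otimes> c \<otimes> c \<or> c \<otimes> c \<otimes> b = b \<otimes> c" "c \<noteq> \<one>" for a b c
  proof
    have "c [^] (2::nat) = c \<otimes> c"
      using that(3) by (simp add: numeral_2_eq_2)
    then show "conj_by G c b = c [^] (2::nat) \<or> conj_by G (c [^] (2::nat)) b = c"
      using that(2,3,7) m_assoc[of b c c] by (simp add: conj_by_def conj_eq_iff)
    show "internal_direct_product G {a} {b, c}"
    proof (rule internal_direct_productI)
      show "t \<otimes> a = a \<otimes> t" if "t \<in> {b, c}" for t
        using that \<open>a \<otimes> b = b \<otimes> a\<close> \<open>a \<otimes> c = c \<otimes> a\<close> by auto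
      fix z assume z: "z \<in> generate G {b, c}" and comm: "\<And>t. t \<in> {b, c} \<Longrightarrow> t \<otimes> z = z \<otimes> t"
      have zG: "z \<in> carrier G"
        using z generate_incl[of "{b, c}"] that(2,3) by auto
      have zbc: "z \<otimes> b = b \<otimes> z" "z \<otimes> c = c \<otimes> z"
        using comm by auto
      show "z = \<one>"
        using that(7)
      proof
        assume "c \<otimes> b = b \<otimes> c \<otimes> c"
        then show ?thesis
          using baumslag_solitar_center_trivial[OF that(2,3) _ that(8) z zbc] by simp
      next
        assume rel: "c \<otimes> c \<otimes> b = b \<otimes> c"
        \<comment> \<open>The second alternative is the first with \<open>b\<close> replaced by its
          inverse, which generates the same subgroup together with \<open>c\<close>.\<close>
        have "inv b \<otimes> (b \<otimes> c) \<otimes> inv b = inv b \<otimes> (c \<otimes> c \<otimes> b) \<otimes> inv b"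
          by (simp add: rel)
        then have rel': "c \<otimes> inv b = inv b \<otimes> c \<otimes> c"
          using that(2,3) by (simp add: m_assoc)
        have zb': "z \<otimes> inv b = inv b \<otimes> z"
          by (rule sym, rule generate_commute[of "{b}"])
            (use zbc(1) zG that(2) in \<open>auto intro: generate.inv\<close>)
        have "inv (inv b) \<in> generate G {inv b, c}"
          by (rule generate.inv) simp
        then have "{b, c} \<subseteq> generate G {inv b, c}"
          using that(2) by (auto intro: generate.incl)
        then have "z \<in> generate G {inv b, c}"
          using z generate_subgroup_incl generate_is_subgroup[of "{inv b, c}"] that(2,3) by blast
        then show ?thesis
          using baumslag_solitar_center_trivial[OF _ that(3) rel' that(8) _ zb' zbc(2)] that(2) by simp
      qed
    qed (use that(1-4) in simp_all)
  qed
  moreover have "conj_by G a b = a [^] (2::nat)"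
    if "a \<in> carrier G" "b \<in> carrier G" "a \<otimes> b = b \<otimes> a \<otimes> a" for a b
    using that by (simp add: conj_by_def conj_eq_iff m_assoc numeral_2_eq_2)
  moreover have "conj_by G a (b [^] (2::nat)) = a \<otimes> conj_by G a b \<and> comm G a (conj_by G a b) = \<one>"
    if "a \<in> carrier G" "b \<in> carrier G" "f \<in> carrier G"
      "a \<otimes> b = b \<otimes> f" "f \<otimes> b = b \<otimes> a \<otimes> f" "a \<otimes> f = f \<otimes> a" for a b f
  proof -
    have f: "conj_by G a b = f"
      using that(1-4) by (simp add: conj_by_def conj_eq_iff)
    have "a \<otimes> (b \<otimes> b) = b \<otimes> (f \<otimes> b)"
      using that(1-4) by (metis m_assoc)
    also have "\<dots> = b \<otimes> b \<otimes> (a \<otimes> f)"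
      unfolding that(5) using that(1-3) by (simp add: m_assoc)
    finally have "conj_by G a (b [^] (2::nat)) = a \<otimes> f"
      using that(1-3) by (simp add: conj_by_def conj_eq_iff numeral_2_eq_2)
    moreover have "comm G a f = inv a \<otimes> (inv f \<otimes> (a \<otimes> f))"
      using that(1,3) by (simp add: comm_def m_assoc)
    then have "comm G a f = \<one>"
      unfolding that(6) using that(1,3) by simp
    ultimately show ?thesis
      by (simp add: f)
  qed
  ultimately show ?thesis
    using assms unfolding young_def young_relations_def by meson
qed

lemma ordered_group_subgroup_generated:
  "ordered_group (subgroup_generated G A) (Restr r (carrier (subgroup_generated G A)))"
proof (intro ordered_group.intro ordered_group_axioms.intro group_subgroup_generated)
  let ?H = "carrier (subgroup_generated G A)"
  have H: "?H \<subseteq> carrier G"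
    by (rule carrier_subgroup_generated_subset)
  note f = linear_order_relation_facts[OF linear_order]
  have "refl_on ?H (Restr r ?H)"
    using f(1) H by (auto simp: refl_on_def)
  moreover have "trans (Restr r ?H)"
    by (rule transI) (use f(2) in blast)
  moreover have "antisym (Restr r ?H)"
    by (rule antisymI) (use f(3) in blast)
  moreover have "total_on ?H (Restr r ?H)"
    using linear_order_total_relation[OF linear_order] H by (auto simp: total_on_def)
  ultimately show "linear_order_on ?H (Restr r ?H)"
    by (auto simp: order_on_defs)
  show "(x \<otimes>\<^bsub>subgroup_generated G A\<^esub> u \<otimes>\<^bsub>subgroup_generated G A\<^esub> y,
      x \<otimes>\<^bsub>subgroup_generated G A\<^esub> v \<otimes>\<^bsub>subgroup_generated G A\<^esub> y) \<in> Restr r ?H"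
    if "u \<in> ?H" "v \<in> ?H" "x \<in> ?H" "y \<in> ?H" "(u, v) \<in> Restr r ?H" for u v x y
  proof -
    interpret H: group "subgroup_generated G A"
      by (rule group_subgroup_generated)
    have "x \<otimes>\<^bsub>subgroup_generated G A\<^esub> u \<otimes>\<^bsub>subgroup_generated G A\<^esub> y \<in> ?H"
      "x \<otimes>\<^bsub>subgroup_generated G A\<^esub> v \<otimes>\<^bsub>subgroup_generated G A\<^esub> y \<in> ?H"
      by (rule H.m_closed[OF H.m_closed[OF that(3,1)] that(4)]
          H.m_closed[OF H.m_closed[OF that(3,2)] that(4)])+
    moreover have "(x \<otimes> u \<otimes> y, x \<otimes> v \<otimes> y) \<in> r"
      using that H by (intro order_mult_mono) auto
    ultimately show ?thesis
      by simp
  qed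
qed

end

theorem theorem2p7:
  fixes G (structure) and r :: "('a \<times> 'a) set" and S :: "'a set"
  assumes "ordered_group G r"
    and "S \<subseteq> carrier G" and "finite S"
    and "card S \<ge> 4"
    and "card (S <#> S) = 3 * card S - 2"
  shows "comm_group (subgroup_generated G S) \<or>
    young (subgroup_generated G S) (Restr r (carrier (subgroup_generated G S)))"
proof -
  interpret G: ordered_group G r
    by (rule assms(1))
  let ?H = "subgroup_generated G S"
  \<comment> \<open>Inside this subgroup \<open>S\<close> generates the whole carrier, and its
    products are those computed in \<open>G\<close>, so the cardinality of the square is
    unchanged.\<close>
  interpret H: ordered_group ?H "Restr r (carrier ?H)"
    by (rule G.ordered_group_subgroup_generated)
  have S: "S \<subseteq> carrier ?H"
    by (rule G.subgroup_generated_subset_carrier_subset[OF assms(2)])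
  have "carrier ?H = carrier (subgroup_generated ?H S)"
    by simp
  then have gen: "carrier ?H = generate ?H S"
    using S by (simp only: carrier_subgroup_generated[of ?H S] Int_absorb1)
  have "S <#>\<^bsub>?H\<^esub> S = S <#> S"
    by (simp add: set_mult_def)
  then have card: "card (S <#>\<^bsub>?H\<^esub> S) + 2 = 3 * card S"
    using assms(4,5) by simp
  show ?thesis
    using H.commuting_imp_comm_group[OF S _ gen] H.young_relations_imp_young
      H.small_doubling_young_relations[OF assms(3) S assms(4) card _ gen] by blast
qed

end
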